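(* Consider the hexagonal network under Model 1 with both Tx- and Rx-cooperation and an unlimited number of cooperation rounds ($D=\infty$), as defined in the context. For $\rho\in(0,1]$ and $\rho_f\in[0,1]$, the fundamental MG region $\mathcal S_1^\star(D=\infty,\rho,\rho_f)$ includes all nonnegative pairs $(S^{(U)},S^{(e)})$ satisfying $$S^{(U)}\le\frac{\rho\rho_f}{3},\qquad S^{(e)}+S^{(U)}\le\rho.$$
   Context: Hexagonal network: for each $K$ there are $K$ hexagonal cells indexed by $\mathcal K=\{1,\dots,K\}$, each with one transmitter (Tx) and one receiver (Rx). Cell $k$ has position $o_k=a_k\mathbf e_x+b_k\mathbf e_y$ in the complex plane with distinct integer pairs $(a_k,b_k)$, where $\mathbf e_x=\frac{\sqrt3}{2}-\frac12 i$ and $\mathbf e_y=i$. The neighbour set and interference set of $k$ coincide: $\mathcal N_k=\mathcal I_k$ is the set of the (at most six) adjacent cells $k'\in\mathcal K$, i.e. those with $(a_k-a_{k'},b_k-b_{k'})\in\{\pm(1,0),\pm(0,1),\pm(1,1)\}$ (equivalently $|o_k-o_{k'}|=1$). Activity. Each Tx $k$ is active ($A_k=1$) with probability $\rho$, independently over $k$, and $A_k=0$ otherwise. Given that Tx $k$ is active, $B_k=1$ with probability $\rho_f$, independently of everything else, and $B_k=0$ otherwise. Let $\mathcal K_{active}=\{k:A_k=1\}$, $\mathcal K_{URLLC}=\{k:A_k=1,B_k=1\}$. Model 1: every active Tx has an eMBB message, i.e. $\mathcal K_{eMBB}=\mathcal K_{active}$, and each Tx in $\mathcal K_{URLLC}$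 additionally has a URLLC message. Write $\mathbf A,\mathbf B$ for the activity tuples; all terminals know $(\mathbf A,\mathbf B)$. Messages. For blocklength $n$, the eMBB message $M_k^{(e)}$ ($k\in\mathcal K_{eMBB}$) is uniform on $\{1,\dots,\lfloor 2^{nR_k^{(e)}}\rfloor\}$, where $R_k^{(e)}$ may depend on $k$ and on $(\mathbf A,\mathbf B)$. The URLLC message $M_k^{(U)}$ ($k\in\mathcal K_{URLLC}$) is uniform on $\{1,\dots,\lfloor 2^{nR^{(U)}}\rfloor\}$, with the same rate $R^{(U)}$ for all $k$, not depending on $(\mathbf A,\mathbf B)$. Messages are independent. Channel. For $t=1,\dots,n$, $Y_{k,t}=h_{k,k}X_{k,t}+\sum_{\tilde k\in\mathcal I_k}h_{\tilde k,k}X_{\tilde k,t}+Z_{k,t}$, where inactive Txs send zero, the $h_{\tilde k,k}\ge 0$ are fixed real numbers, and the $Z_{k,t}$ are i.i.d. standard Gaussian, independent of all messages. Communication with both Tx- and Rx-cooperation; $D=\infty$ means that the numbers of Tx- and Rx-cooperation rounds may be any finite numbers. (i) Tx-cooperation rounds: in each round every active Tx $k$ sends to each active neighbour in $\mathcal N_k$ over a noise-free link of unlimited capacity an arbitrary function of its eMBB message (if it has one), the cooperation messages it received in previous rounds, and $(\mathbf A,\mathbf B)$ (not of URLLC messages). (ii) Each active Tx $k$ computes $X_k^n$ as a function of its own URLLC and eMBB messages (those that exist), all cooperation messages it received, and $(\mathbf A,\mathbf B)$, subject to $\frac1n\sum_{t=1}^n X_{k,t}^2\le P$ almost surely. (iii)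 Each Rx $k\in\mathcal K_{URLLC}$ decodes $M_k^{(U)}$ from $Y_k^n$ and $(\mathbf A,\mathbf B)$ only. (iv) Rx-cooperation rounds: in each round every active Rx $k$ sends to each active neighbour in $\mathcal N_k$ over a noise-free link of unlimited capacity an arbitrary function of $Y_k^n$, the cooperation messages it received in previous rounds, and $(\mathbf A,\mathbf B)$. (v) Each Rx $k\in\mathcal K_{eMBB}$ decodes $M_k^{(e)}$ from $Y_k^n$, all cooperation messages it received, and $(\mathbf A,\mathbf B)$. Achievability. For given $P,K$, a pair $(R^{(U)}(P),\bar R_K^{(e)}(P))$ is achievable if there exist rates $R_k^{(e)}$ with $\bar R_K^{(e)}\le \mathbb E_{\mathbf A,\mathbf B}\big[\frac1K\sum_{k\in\mathcal K_{eMBB}}R_k^{(e)}\big]$ and, for some finite numbers of Tx- and Rx-cooperation rounds, Tx-cooperation functions (of the own eMBB message, the previously received Tx-cooperation messages and $(\mathbf A,\mathbf B)$), encoding functions (of the own messages, the received Tx-cooperation messages and $(\mathbf A,\mathbf B)$, obeying the power constraint $\frac1n\sum_{t=1}^n X_{k,t}^2\le P$ almost surely), URLLC decoding functions (of $Y_k^n$ and $(\mathbf A,\mathbf B)$), Rx-cooperation functions (of $Y_k^n$, the previously received Rx-cooperation messages and $(\mathbf A,\mathbf B)$) and eMBB decoding functions (of $Y_k^n$, all received Rx-cooperation messages and $(\mathbf A,\mathbf B)$) such that the probability that some URLLC message ($k\in\mathcal K_{URLLC}$) or some eMBB message ($k\in\mathcal K_{eMBB}$) is decoded incorrectly tends to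 $0$ as $n\to\infty$. A multiplexing gain (MG) pair $(S^{(U)},S^{(e)})$ is achievable if for all $P>0$ (and all $K$) there exist achievable rates with $S^{(U)}=\rho\rho_f\,\varlimsup_{K\to\infty}\varlimsup_{P\to\infty}\frac{R^{(U)}(P)}{\frac12\log P}$ and $S^{(e)}=\varlimsup_{K\to\infty}\varlimsup_{P\to\infty}\frac{\bar R_K^{(e)}(P)}{\frac12\log P}$. The fundamental MG region $\mathcal S_1^\star(D=\infty,\rho,\rho_f)$ is the closure of the set of all achievable MG pairs under Model 1.
   Formalization: The channel coefficients are additionally assumed generic: for every set S of cells the S×S channel matrix is invertible (so h_{k,k}>0); for arbitrary fixed nonnegative coefficients, e.g. all zero, the claim is false. *)

theory Defs
  imports "HOL-Probability.Probability"
begin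

text \<open>
  The cells of a network of size K are the indices 1, ..., K.  Cell k sits at the lattice point
  a_k e_x + b_k e_y, where e_x = sqrt 3 / 2 - i / 2 and e_y = i, and is represented by the integer
  pair \<^term>\<open>pos k = (a_k, b_k)\<close>.  The coefficient \<^term>\<open>h j k\<close> belongs to the
  path from Tx j to Rx k.
\<close>

definition hex_basis_x :: complex where
  "hex_basis_x = Complex (sqrt 3 / 2) (- 1 / 2)"

definition cell_position :: "int \<times> int \<Rightarrow> complex" where
  "cell_position p = of_int (fst p) * hex_basis_x + of_int (snd p) * \<i>"

definition hex_neighbours :: "nat \<Rightarrow> (nat \<Rightarrow> int \<times> int) \<Rightarrow> nat \<Rightarrow> nat set" where
  "hex_neighbours K pos k =
     {k' \<in> {1..K}. (fst (pos k) - fst (pos k'), snd (pos k) - snd (pos k'))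
        \<in> {(1, 0), (-1, 0), (0, 1), (0, -1), (1, 1), (-1, -1)}}"

lemma hex_neighbours_iff_dist:
  "hex_neighbours K pos k =
     {k' \<in> {1..K}. dist (cell_position (pos k)) (cell_position (pos k')) = 1}"
proof -
  have *: "(x, y) \<in> {(1, 0), (-1, 0), (0, 1), (0, -1), (1, 1), (-1, -1)} \<longleftrightarrow>
      x * x - x * y + y * y = 1" for x y :: int
  proof
    assume eq: "x * x - x * y + y * y = 1"
    have "3 * (x * x) + (x - 2 * y) * (x - 2 * y) = 4"
      "3 * (y * y) + (y - 2 * x) * (y - 2 * x) = 4"
      using eq by (simp_all add: algebra_simps)
    then have "x * x < 2 * 2" "y * y < 2 * 2"
      using zero_le_square[of "x - 2 * y"] zero_le_square[of "y - 2 * x"] by linarith+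
    then have "\<bar>x\<bar> < 2" "\<bar>y\<bar> < 2"
      using abs_le_square_iff[of 2 x] abs_le_square_iff[of 2 y]
      by (auto simp: power2_eq_square not_le[symmetric])
    then have "x \<in> {-1, 0, 1}" "y \<in> {-1, 0, 1}" by auto
    then show "(x, y) \<in> {(1, 0), (-1, 0), (0, 1), (0, -1), (1, 1), (-1, -1)}"
      using eq by auto
  qed auto
  have **: "dist (cell_position p) (cell_position q) = 1 \<longleftrightarrow>
      (let x = fst p - fst q; y = snd p - snd q in x * x - x * y + y * y = 1)" for p q
  proof -
    define x y where "x = fst p - fst q" and "y = snd p - snd q"
    have "cell_position p - cell_position q = cell_position (x, y)"
      by (simp add: cell_position_def x_def y_def algebra_simps)
    then have "(dist (cell_position p) (cell_position q))\<^sup>2 = (cmod (cell_position (x, y)))\<^sup>2"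
      by (simp add: dist_norm)
    also have "\<dots> = (of_int x * (sqrt 3 / 2))\<^sup>2 + (of_int y - of_int x / 2)\<^sup>2"
      by (simp add: cmod_power2 cell_position_def hex_basis_x_def)
    also have "\<dots> = of_int (x * x - x * y + y * y)"
      by (simp add: power_mult_distrib power_divide power2_eq_square field_simps)
    finally have sq: "(dist (cell_position p) (cell_position q))\<^sup>2
      = of_int (x * x - x * y + y * y)" .
    have "dist (cell_position p) (cell_position q) = 1 \<longleftrightarrow>
        (dist (cell_position p) (cell_position q))\<^sup>2 = 1"
      by (simp add: power2_eq_1_iff) (smt (verit) zero_le_dist)
    also have "\<dots> \<longleftrightarrow> x * x - x * y + y * y = 1"
      unfolding sq using of_int_eq_1_iff by blast
    finally show ?thesis by (simp add: x_def y_def Let_def)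
  qed
  show ?thesis
    unfolding hex_neighbours_def ** * Let_def by simp
qed

definition channel_gain ::
  "nat \<Rightarrow> (nat \<Rightarrow> int \<times> int) \<Rightarrow> (nat \<Rightarrow> nat \<Rightarrow> real) \<Rightarrow> nat \<Rightarrow> nat \<Rightarrow> real" where
  "channel_gain K pos h j k = (if j = k \<or> j \<in> hex_neighbours K pos k then h j k else 0)"

text \<open>
  Genericity of the channel: for every set S of cells, the channel matrix between the Txs and the
  Rxs of S has trivial kernel.  Lebesgue-almost every array of coefficients has this property.
  Without such a condition the multiplexing gain of two adjacent active cells can drop below 2
  (all coefficients equal to 1), and that of a single cell below 1 (direct coefficient 0).
\<close>

definition generic_gains :: "nat \<Rightarrow> (nat \<Rightarrow> int \<times> int) \<Rightarrow> (nat \<Rightarrow> nat \<Rightarrow> real) \<Rightarrow> bool" where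
  "generic_gains K pos h \<longleftrightarrow>
     (\<forall>S \<subseteq> {1..K}. \<forall>x :: nat \<Rightarrow> real.
        (\<forall>k\<in>S. (\<Sum>j\<in>S. channel_gain K pos h j k * x j) = 0) \<longrightarrow> (\<forall>j\<in>S. x j = 0))"


subsection \<open>Activity and messages\<close>

text \<open>A state \<^term>\<open>s\<close> collects the activity tuples: \<^term>\<open>s k = (A_k, B_k)\<close>.\<close>

type_synonym activity = "nat \<Rightarrow> bool \<times> bool"

definition active_set :: "nat \<Rightarrow> activity \<Rightarrow> nat set" where
  "active_set K s = {k \<in> {1..K}. fst (s k)}"

definition urllc_set :: "nat \<Rightarrow> activity \<Rightarrow> nat set" where
  "urllc_set K s = {k \<in> {1..K}. fst (s k) \<and> snd (s k)}"

text \<open>Model 1: every active Tx has an eMBB message.\<close>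

definition embb_set :: "nat \<Rightarrow> activity \<Rightarrow> nat set" where
  "embb_set K s = active_set K s"

definition cell_activity_pmf :: "real \<Rightarrow> real \<Rightarrow> (bool \<times> bool) pmf" where
  "cell_activity_pmf \<rho> \<rho>f =
     bind_pmf (bernoulli_pmf \<rho>) (\<lambda>a.
       if a then map_pmf (\<lambda>b. (True, b)) (bernoulli_pmf \<rho>f) else return_pmf (False, False))"

definition activity_pmf :: "nat \<Rightarrow> real \<Rightarrow> real \<Rightarrow> activity pmf" where
  "activity_pmf K \<rho> \<rho>f = Pi_pmf {1..K} (False, False) (\<lambda>_. cell_activity_pmf \<rho> \<rho>f)"

definition message_count :: "nat \<Rightarrow> real \<Rightarrow> nat" where
  "message_count n R = nat \<lfloor>2 powr (real n * R)\<rfloor>"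

text \<open>A pair of URLLC and eMBB message tuples; messages that do not exist have the value 0.\<close>

type_synonym messages = "(nat \<Rightarrow> nat) \<times> (nat \<Rightarrow> nat)"

definition messages_pmf ::
  "nat \<Rightarrow> nat \<Rightarrow> real \<Rightarrow> (activity \<Rightarrow> nat \<Rightarrow> real) \<Rightarrow> activity \<Rightarrow> messages pmf" where
  "messages_pmf K n RU RE s = pair_pmf
     (Pi_pmf (urllc_set K s) 0 (\<lambda>_. pmf_of_set {1..message_count n RU}))
     (Pi_pmf (embb_set K s) 0 (\<lambda>k. pmf_of_set {1..message_count n (RE s k)}))"


subsection \<open>Cooperation\<close>

text \<open>
  \<^term>\<open>coop_history link d f r k i l\<close> is the cooperation message that terminal k received from
  terminal l in round i, among the rounds 0, ..., r - 1; it is the dummy d if there is none.  In round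
  r, terminal l sends \<^term>\<open>f r l k hist\<close> to terminal k, where \<^term>\<open>hist\<close> is what l
  received in the earlier rounds.
\<close>

primrec coop_history ::
  "(nat \<Rightarrow> nat \<Rightarrow> bool) \<Rightarrow> 'm \<Rightarrow> (nat \<Rightarrow> nat \<Rightarrow> nat \<Rightarrow> (nat \<Rightarrow> nat \<Rightarrow> 'm) \<Rightarrow> 'm) \<Rightarrow>
    nat \<Rightarrow> nat \<Rightarrow> nat \<Rightarrow> nat \<Rightarrow> 'm" where
  "coop_history link d f 0 = (\<lambda>k i l. d)"
| "coop_history link d f (Suc r) = (\<lambda>k i l.
     if i = r then (if link l k then f r l k (coop_history link d f r l) else d)
     else coop_history link d f r k i l)"

definition coop_link :: "nat \<Rightarrow> (nat \<Rightarrow> int \<times> int) \<Rightarrow> activity \<Rightarrow> nat \<Rightarrow> nat \<Rightarrow> bool" where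
  "coop_link K pos s l k \<longleftrightarrow>
     l \<in> active_set K s \<and> k \<in> active_set K s \<and> k \<in> hex_neighbours K pos l"


subsection \<open>Codes\<close>

text \<open>
  Every function of a code receives the activity tuples first.  Length-n blocks are functions
  on \<^typ>\<open>nat\<close> that vanish outside 1, ..., n.  A Tx-cooperation message is a natural number, which
  is no restriction because the messages it is computed from take finitely many values.
  An Rx-cooperation message is a real sequence, so that a whole output block, and everything
  received before, fits into one message.
\<close>

record code =
  tx_coop :: "activity \<Rightarrow> nat \<Rightarrow> nat \<Rightarrow> nat \<Rightarrow> nat \<Rightarrow> (nat \<Rightarrow> nat \<Rightarrow> nat) \<Rightarrow> nat"
    \<comment> \<open>round, sender, receiver, eMBB message, received Tx-cooperation messages\<close>
  encode :: "activity \<Rightarrow> nat \<Rightarrow> nat \<Rightarrow> nat \<Rightarrow> (nat \<Rightarrow> nat \<Rightarrow> nat) \<Rightarrow> nat \<Rightarrow> real"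
    \<comment> \<open>cell, URLLC message, eMBB message, received Tx-cooperation messages, time\<close>
  decode_urllc :: "activity \<Rightarrow> nat \<Rightarrow> (nat \<Rightarrow> real) \<Rightarrow> nat"
    \<comment> \<open>cell, output block\<close>
  rx_coop :: "activity \<Rightarrow> nat \<Rightarrow> nat \<Rightarrow> nat \<Rightarrow> (nat \<Rightarrow> real) \<Rightarrow> (nat \<Rightarrow> nat \<Rightarrow> nat \<Rightarrow> real) \<Rightarrow> nat \<Rightarrow> real"
    \<comment> \<open>round, sender, receiver, output block, received Rx-cooperation messages\<close>
  decode_embb :: "activity \<Rightarrow> nat \<Rightarrow> (nat \<Rightarrow> real) \<Rightarrow> (nat \<Rightarrow> nat \<Rightarrow> nat \<Rightarrow> real) \<Rightarrow> nat"
    \<comment> \<open>cell, output block, received Rx-cooperation messages\<close>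

text \<open>
  Measurability makes the error event below an event.  On countable products of the
  reals, \<^term>\<open>borel\<close> is the product sigma-algebra.
\<close>

definition measurable_code :: "code \<Rightarrow> bool" where
  "measurable_code c \<longleftrightarrow>
     (\<forall>s k. decode_urllc c s k \<in> borel \<rightarrow>\<^sub>M count_space UNIV) \<and>
     (\<forall>s r l k. case_prod (rx_coop c s r l k) \<in> borel \<Otimes>\<^sub>M borel \<rightarrow>\<^sub>M borel) \<and>
     (\<forall>s k. case_prod (decode_embb c s k) \<in> borel \<Otimes>\<^sub>M borel \<rightarrow>\<^sub>M count_space UNIV)"

definition channel_input ::
  "nat \<Rightarrow> (nat \<Rightarrow> int \<times> int) \<Rightarrow> nat \<Rightarrow> code \<Rightarrow> activity \<Rightarrow> messages \<Rightarrow> nat \<Rightarrow> nat \<Rightarrow> real" where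
  "channel_input K pos DT c s m k t =
     (if k \<in> active_set K s
      then encode c s k (fst m k) (snd m k)
             (coop_history (coop_link K pos s) 0 (\<lambda>r l k'. tx_coop c s r l k' (snd m l)) DT k) t
      else 0)"

definition channel_output ::
  "nat \<Rightarrow> (nat \<Rightarrow> int \<times> int) \<Rightarrow> (nat \<Rightarrow> nat \<Rightarrow> real) \<Rightarrow> nat \<Rightarrow> (nat \<Rightarrow> nat \<Rightarrow> real) \<Rightarrow>
    (nat \<times> nat \<Rightarrow> real) \<Rightarrow> nat \<Rightarrow> nat \<Rightarrow> real" where
  "channel_output K pos h n x z k t =
     (if t \<in> {1..n}
      then h k k * x k t + (\<Sum>j\<in>hex_neighbours K pos k. h j k * x j t) + z (k, t)
      else 0)"

definition noise_measure :: "nat \<Rightarrow> nat \<Rightarrow> (nat \<times> nat \<Rightarrow> real) measure" where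
  "noise_measure K n = Pi\<^sub>M ({1..K} \<times> {1..n}) (\<lambda>_. density lborel std_normal_density)"

definition decoding_error ::
  "nat \<Rightarrow> (nat \<Rightarrow> int \<times> int) \<Rightarrow> (nat \<Rightarrow> nat \<Rightarrow> real) \<Rightarrow> nat \<Rightarrow> nat \<Rightarrow> nat \<Rightarrow> code \<Rightarrow>
    activity \<Rightarrow> messages \<Rightarrow> (nat \<times> nat \<Rightarrow> real) \<Rightarrow> bool" where
  "decoding_error K pos h DT DR n c s m z \<longleftrightarrow>
     (let y = channel_output K pos h n (channel_input K pos DT c s m) z;
          hist = coop_history (coop_link K pos s) (\<lambda>_. 0)
                   (\<lambda>r l k. rx_coop c s r l k (y l)) DR
      in (\<exists>k\<in>urllc_set K s. decode_urllc c s k (y k) \<noteq> fst m k) \<or>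
         (\<exists>k\<in>embb_set K s. decode_embb c s k (y k) (hist k) \<noteq> snd m k))"

text \<open>The law of the messages depends on the activity, so the average is taken in stages.\<close>

definition error_prob ::
  "nat \<Rightarrow> (nat \<Rightarrow> int \<times> int) \<Rightarrow> (nat \<Rightarrow> nat \<Rightarrow> real) \<Rightarrow> real \<Rightarrow> real \<Rightarrow> real \<Rightarrow>
    (activity \<Rightarrow> nat \<Rightarrow> real) \<Rightarrow> nat \<Rightarrow> nat \<Rightarrow> nat \<Rightarrow> code \<Rightarrow> real" where
  "error_prob K pos h \<rho> \<rho>f RU RE DT DR n c =
     measure_pmf.expectation (activity_pmf K \<rho> \<rho>f) (\<lambda>s.
       measure_pmf.expectation (messages_pmf K n RU RE s) (\<lambda>m.
         measure (noise_measure K n)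
           {z \<in> space (noise_measure K n). decoding_error K pos h DT DR n c s m z}))"

definition power_constraint ::
  "nat \<Rightarrow> (nat \<Rightarrow> int \<times> int) \<Rightarrow> real \<Rightarrow> real \<Rightarrow> real \<Rightarrow> real \<Rightarrow>
    (activity \<Rightarrow> nat \<Rightarrow> real) \<Rightarrow> nat \<Rightarrow> nat \<Rightarrow> code \<Rightarrow> bool" where
  "power_constraint K pos \<rho> \<rho>f P RU RE DT n c \<longleftrightarrow>
     (AE s in measure_pmf (activity_pmf K \<rho> \<rho>f).
      AE m in measure_pmf (messages_pmf K n RU RE s).
        \<forall>k\<in>active_set K s. (1 / real n) * (\<Sum>t=1..n. (channel_input K pos DT c s m k t)\<^sup>2) \<le> P)"


subsection \<open>Achievable rates and multiplexing gains\<close>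

definition achievable_rates ::
  "nat \<Rightarrow> (nat \<Rightarrow> int \<times> int) \<Rightarrow> (nat \<Rightarrow> nat \<Rightarrow> real) \<Rightarrow> real \<Rightarrow> real \<Rightarrow> real \<Rightarrow> real \<Rightarrow> real \<Rightarrow> bool" where
  "achievable_rates K pos h \<rho> \<rho>f P RU REbar \<longleftrightarrow>
     0 \<le> RU \<and> 0 \<le> REbar \<and>
     (\<exists>RE :: activity \<Rightarrow> nat \<Rightarrow> real.
        (\<forall>s. \<forall>k\<in>{1..K}. 0 \<le> RE s k) \<and>
        REbar \<le> measure_pmf.expectation (activity_pmf K \<rho> \<rho>f)
                   (\<lambda>s. 1 / real K * (\<Sum>k\<in>embb_set K s. RE s k)) \<and>
        (\<exists>DT DR. \<exists>c :: nat \<Rightarrow> code.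
           (\<forall>n\<ge>1. measurable_code (c n) \<and> power_constraint K pos \<rho> \<rho>f P RU RE DT n (c n)) \<and>
           (\<lambda>n. error_prob K pos h \<rho> \<rho>f RU RE DT DR n (c n)) \<longlonglongrightarrow> 0))"

definition mg :: "(nat \<Rightarrow> real \<Rightarrow> real) \<Rightarrow> ereal" where
  "mg R = limsup (\<lambda>K. Limsup at_top (\<lambda>P. ereal (R K P / (1 / 2 * log 2 P))))"

text \<open>The family of networks is given by one layout and one array of coefficients for each K.\<close>

definition achievable_mg_pair ::
  "(nat \<Rightarrow> nat \<Rightarrow> int \<times> int) \<Rightarrow> (nat \<Rightarrow> nat \<Rightarrow> nat \<Rightarrow> real) \<Rightarrow> real \<Rightarrow> real \<Rightarrow> real \<times> real \<Rightarrow> bool" where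
  "achievable_mg_pair pos h \<rho> \<rho>f S \<longleftrightarrow>
     (\<exists>RU REbar :: nat \<Rightarrow> real \<Rightarrow> real.
        (\<forall>K\<ge>1. \<forall>P>0. achievable_rates K (pos K) (h K) \<rho> \<rho>f P (RU K P) (REbar K P)) \<and>
        ereal (fst S) = ereal (\<rho> * \<rho>f) * mg RU \<and>
        ereal (snd S) = mg REbar)"

definition mg_region ::
  "(nat \<Rightarrow> nat \<Rightarrow> int \<times> int) \<Rightarrow> (nat \<Rightarrow> nat \<Rightarrow> nat \<Rightarrow> real) \<Rightarrow> real \<Rightarrow> real \<Rightarrow> (real \<times> real) set" where
  "mg_region pos h \<rho> \<rho>f = closure {S. achievable_mg_pair pos h \<rho> \<rho>f S}"

end

theory Submission
  imports Defs
begin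

text \<open>
  The cells are 3-coloured so that adjacent cells differ, and each colour gets a phase of
  \<open>\<alpha> n\<close> symbols in which its URLLC cells send their URLLC messages; in all other symbols an
  active cell sends its eMBB message.  After one Tx-cooperation round a URLLC Tx knows the eMBB
  messages of its neighbours, none of which sends URLLC in the same phase, so it subtracts their
  interference and its Rx sees a clean scalar channel.  The Rxs flood their outputs through their
  connected component and invert its channel matrix, which leaves a scalar channel for every eMBB
  message.

  The codewords are integer points with pairwise squared distance above a multiple of n, found
  greedily.  They cost only a constant number of bits per symbol, which is invisible in the
  multiplexing gain, and decode correctly whenever the total noise energy is at most four times its
  mean.  Choosing \<open>\<alpha>\<close> in \<open>[0, 1/3]\<close> gives the gains
  \<open>(\<rho> \<rho>f \<alpha>, \<rho> - \<rho> \<rho>f \<alpha>)\<close> up to a factor \<open>1 - \<epsilon>\<close>, which the closure removes.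
\<close>


section \<open>Chernoff bound for the energy of Gaussian noise\<close>

subsection \<open>Noise energy\<close>

text \<open>The exponential factor halves the exponent of the standard density, leaving
  \<open>sqrt 2\<close> times a normal density of variance 2.\<close>

lemma nn_integral_exp_square_std_normal:
  "(\<integral>\<^sup>+x. ennreal (exp (x\<^sup>2 / 4)) \<partial>density lborel std_normal_density) = ennreal (sqrt 2)"
proof -
  have "std_normal_density x * exp (x\<^sup>2 / 4) = sqrt 2 * normal_density 0 (sqrt 2) x" for x
    by (simp add: normal_density_def real_sqrt_mult mult_exp_exp field_simps)
  then have "(\<integral>\<^sup>+x. ennreal (exp (x\<^sup>2 / 4)) \<partial>density lborel std_normal_density)
      = (\<integral>\<^sup>+x. ennreal (sqrt 2 * normal_density 0 (sqrt 2) x) \<partial>lborel)"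
    by (simp add: nn_integral_density ennreal_mult'[symmetric])
  also have "\<dots> = ennreal (sqrt 2)"
    by (subst nn_integral_eq_integral) auto
  finally show ?thesis .
qed

text \<open>Markov's inequality for the exponential of a quarter of the energy. Each coordinate
  contributes \<open>sqrt 2\<close> from its exponential moment and \<open>exp (-1)\<close> from the
  threshold.\<close>

lemma gaussian_energy_tail:
  assumes "finite I"
  defines "M \<equiv> Pi\<^sub>M I (\<lambda>_. density lborel std_normal_density)"
  shows "measure M {z \<in> space M. 4 * real (card I) < (\<Sum>i\<in>I. (z i)\<^sup>2)} \<le> (sqrt 2 / exp 1) ^ card I"
proof -
  have "prob_space (density lborel std_normal_density)"
    by (rule prob_space_normal_density) simp
  then have "sigma_finite_measure (density lborel std_normal_density)"
    by (simp add: prob_space_imp_sigma_finite)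
  then interpret product_sigma_finite "\<lambda>_. density lborel std_normal_density"
    by (simp add: product_sigma_finite_def)
  let ?u = "\<lambda>z. \<Prod>i\<in>I. ennreal (exp ((z i)\<^sup>2 / 4))"
  have [measurable]: "(\<lambda>z. z i) \<in> borel_measurable M" if "i \<in> I" for i
    using measurable_component_singleton[OF that, of "\<lambda>_. density lborel std_normal_density"]
    by (simp add: M_def)
  have "emeasure M {z \<in> space M. 4 * real (card I) < (\<Sum>i\<in>I. (z i)\<^sup>2)}
      \<le> emeasure M {z \<in> space M. 1 \<le> ennreal (exp (- real (card I))) * ?u z}"
  proof (intro emeasure_mono subsetI, safe)
    fix z assume "4 * real (card I) < (\<Sum>i\<in>I. (z i)\<^sup>2)"
    then have "1 \<le> exp (- real (card I) + (\<Sum>i\<in>I. (z i)\<^sup>2 / 4))"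
      by (simp add: sum_divide_distrib[symmetric])
    also have "\<dots> = exp (- real (card I)) * (\<Prod>i\<in>I. exp ((z i)\<^sup>2 / 4))"
      using assms(1) by (simp only: exp_add exp_sum)
    finally show "1 \<le> ennreal (exp (- real (card I))) * ?u z"
      by (simp add: prod_ennreal ennreal_mult'[symmetric])
  qed simp
  also have "\<dots> \<le> ennreal (exp (- real (card I))) * (\<integral>\<^sup>+z. ?u z * indicator (space M) z \<partial>M)"
    by (rule nn_integral_Markov_inequality) auto
  also have "(\<integral>\<^sup>+z. ?u z * indicator (space M) z \<partial>M) = (\<integral>\<^sup>+z. ?u z \<partial>M)"
    by (intro nn_integral_cong) simp
  also have "\<dots> = ennreal (sqrt 2) ^ card I"
    unfolding M_def using assms(1)
    by (subst product_nn_integral_prod) (auto simp: nn_integral_exp_square_std_normal)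
  also have "ennreal (exp (- real (card I))) * ennreal (sqrt 2) ^ card I
      = ennreal ((sqrt 2 / exp 1) ^ card I)"
    by (simp add: ennreal_power ennreal_mult'[symmetric] power_divide exp_minus
        exp_of_nat_mult[of _ 1, simplified] divide_inverse power_mult_distrib
        power_inverse mult.commute)
  finally show ?thesis
    unfolding measure_def by (intro enn2real_leI) auto
qed


section \<open>Dual systems, for inverting the channel\<close>

subsection \<open>Zero forcing\<close>

text \<open>The trivial kernel makes the vectors \<open>a i\<close> linearly independent;
  \<open>g\<close> is a dual system for them, built by adding one vector at a time.\<close>

lemma left_inverse_of_trivial_kernel:
  fixes a :: "'i \<Rightarrow> 'k \<Rightarrow> real"
  assumes "finite S"
    and "\<And>x. (\<And>k. k \<in> T \<Longrightarrow> (\<Sum>i\<in>S. a i k * x i) = 0) \<Longrightarrow> \<forall>i\<in>S. x i = 0"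
    and "finite T"
  shows "\<exists>g. \<forall>j\<in>S. \<forall>i\<in>S. (\<Sum>k\<in>T. g j k * a i k) = of_bool (i = j)"
  using assms(1,2)
proof (induction S)
  case (insert s S)
  \<comment> \<open>A relation among the vectors of \<open>S\<close> extends to
    \<open>insert s S\<close> by the coefficient 0 at \<open>s\<close>.\<close>
  have "\<forall>i\<in>S. x i = 0" if "\<And>k. k \<in> T \<Longrightarrow> (\<Sum>i\<in>S. a i k * x i) = 0" for x
  proof -
    have "(\<Sum>i\<in>insert s S. a i k * (x(s := 0)) i) = (\<Sum>i\<in>S. a i k * x i)" for k
      using insert.hyps by (auto intro!: sum.cong)
    then have "\<forall>i\<in>insert s S. (x(s := 0)) i = 0"
      using that by (intro insert.prems) simp
    then show ?thesis using insert.hyps by (metis fun_upd_other insertCI)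
  qed
  then obtain g where g: "\<And>j i. j \<in> S \<Longrightarrow> i \<in> S \<Longrightarrow> (\<Sum>k\<in>T. g j k * a i k) = of_bool (i = j)"
    using insert.IH by metis
  \<comment> \<open>The residual of \<^term>\<open>a s\<close> is nonzero in some coordinate l; reading off that coordinate of
    the residual of a vector is the functional dual to \<^term>\<open>a s\<close>.\<close>
  define c where "c v j = (\<Sum>k\<in>T. g j k * v k)" for v j
  define r where "r v k = v k - (\<Sum>j\<in>S. c v j * a j k)" for v k
  have "\<exists>l\<in>T. r (a s) l \<noteq> 0"
  proof (rule ccontr)
    assume "\<not> ?thesis"
    then have *: "r (a s) k = 0" if "k \<in> T" for k using that by blast
    \<comment> \<open>A vanishing residual writes \<open>a s\<close> in terms of the other vectors,
      a relation with coefficient 1 at \<open>s\<close>.\<close>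
    have "(\<Sum>i\<in>insert s S. a i k * (if i = s then 1 else - c (a s) i)) = r (a s) k" for k
    proof -
      have "(\<Sum>i\<in>S. a i k * (if i = s then 1 else - c (a s) i)) = (\<Sum>i\<in>S. - (c (a s) i * a i k))"
        using insert.hyps by (intro sum.cong) auto
      then show ?thesis using insert.hyps by (simp add: r_def sum_negf)
    qed
    then have "\<forall>i\<in>insert s S. (if i = s then 1 else - c (a s) i) = (0::real)"
      using * by (intro insert.prems) simp
    then show False by auto
  qed
  then obtain l where l: "l \<in> T" "r (a s) l \<noteq> 0" by blast
  have r0: "r (a i) k = 0" if "i \<in> S" for i k
    using that insert.hyps by (simp add: r_def c_def g of_bool_def if_distrib[of "\<lambda>x. x * _"] cong: if_cong)
  \<comment> \<open>The functional taking \<open>v\<close> to \<open>r v l / r (a s) l\<close>, in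
    coordinates: it is 1 at \<open>a s\<close> and 0 at the other vectors.\<close>
  define \<phi> where "\<phi> k = (of_bool (k = l) - (\<Sum>j\<in>S. g j k * a j l)) / r (a s) l" for k
  have \<phi>: "(\<Sum>k\<in>T. \<phi> k * v k) = r v l / r (a s) l" for v
  proof -
    have "(\<Sum>k\<in>T. (of_bool (k = l) - (\<Sum>j\<in>S. g j k * a j l)) * v k)
        = (\<Sum>k\<in>T. of_bool (k = l) * v k) - (\<Sum>k\<in>T. \<Sum>j\<in>S. g j k * v k * a j l)"
      by (simp add: algebra_simps sum_subtractf sum_distrib_left)
    also have "(\<Sum>k\<in>T. of_bool (k = l) * v k) = v l"
      using \<open>finite T\<close> l(1) by (simp add: of_bool_def if_distrib[of "\<lambda>x. x * _"] cong: if_cong)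
    also have "(\<Sum>k\<in>T. \<Sum>j\<in>S. g j k * v k * a j l) = (\<Sum>j\<in>S. c v j * a j l)"
      by (subst sum.swap) (simp add: c_def sum_distrib_right)
    finally show ?thesis by (simp add: \<phi>_def r_def sum_divide_distrib[symmetric])
  qed
  \<comment> \<open>Subtracting a multiple of \<open>\<phi>\<close> makes the old functionals vanish
    at \<open>a s\<close> and keeps their values on the vectors of \<open>S\<close>.\<close>
  define g' where "g' j k = (if j = s then \<phi> k else g j k - c (a s) j * \<phi> k)" for j k
  have "(\<Sum>k\<in>T. g' j k * a i k) = of_bool (i = j)" if "j \<in> insert s S" "i \<in> insert s S" for j i
  proof (cases "j = s")
    case True
    then show ?thesis
      using that l(2) r0 insert.hyps by (auto simp: g'_def \<phi>)
  next
    case False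
    then have "(\<Sum>k\<in>T. g' j k * a i k)
        = (\<Sum>k\<in>T. g j k * a i k) - c (a s) j * (\<Sum>k\<in>T. \<phi> k * a i k)"
      by (simp add: g'_def algebra_simps sum_subtractf sum_distrib_left)
    then show ?thesis
      using False that l(2) r0 insert.hyps g by (auto simp: \<phi> c_def)
  qed
  then show ?case by blast
qed simp


section \<open>Packing integer points, and decoding within half the minimum distance\<close>

subsection \<open>Codebooks\<close>

text \<open>A counting form of the Chernoff bound: weights that decay geometrically in the l1
  distance to the centre factor over the coordinates, and each factor is at most 4.\<close>

lemma card_grid_ball:
  fixes c :: "'t \<Rightarrow> nat"
  assumes "finite T"
  shows "real (card {v \<in> T \<rightarrow>\<^sub>E {..<Q}. (\<Sum>t\<in>T. (real (v t) - real (c t))\<^sup>2) \<le> real B})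
    \<le> 2 ^ B * 4 ^ card T"
proof -
  let ?d = "\<lambda>a b. nat \<bar>int a - int b\<bar>"
  have geo: "(\<Sum>q<n. (1 / 2 :: real) ^ q) \<le> 2" for n
    by (simp add: sum_gp_strict)
  have slice: "(\<Sum>q<Q. (1 / 2 :: real) ^ ?d q x) \<le> 4" for x
  proof -
    \<comment> \<open>The enlarged range splits at \<open>x\<close> into two one-sided geometric
      sums, at most 1 and 2.\<close>
    have "(\<Sum>q<Q. (1 / 2 :: real) ^ ?d q x)
        \<le> (\<Sum>q\<in>{..<x} \<union> {x..<x + Q}. (1 / 2 :: real) ^ ?d q x)"
      by (intro sum_mono2) auto
    also have "\<dots> = (\<Sum>q<x. (1 / 2 :: real) ^ ?d q x) + (\<Sum>q\<in>{x..<x + Q}. (1 / 2) ^ ?d q x)"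
      by (intro sum.union_disjoint) auto
    also have "(\<Sum>q<x. (1 / 2 :: real) ^ ?d q x) = (\<Sum>q<x. (1 / 2) ^ (Suc q))"
      by (rule sum.reindex_bij_witness[of _ "\<lambda>q. x - Suc q" "\<lambda>q. x - Suc q"])
        (auto simp: nat_diff_distrib' simp flip: power_Suc intro!: arg_cong[of _ _ "\<lambda>n. (1/2::real)^n"])
    also have "\<dots> = (1 / 2) * (\<Sum>q<x. (1 / 2) ^ q)"
      by (simp add: sum_distrib_left)
    also have "(\<Sum>q\<in>{x..<x + Q}. (1 / 2 :: real) ^ ?d q x) = (\<Sum>q<Q. (1 / 2) ^ q)"
      by (rule sum.reindex_bij_witness[of _ "\<lambda>q. q + x" "\<lambda>q. q - x"])
        (auto simp: nat_diff_distrib')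
    finally show ?thesis using geo[of x] geo[of Q] by linarith
  qed
  let ?A = "{v \<in> T \<rightarrow>\<^sub>E {..<Q}. (\<Sum>t\<in>T. (real (v t) - real (c t))\<^sup>2) \<le> real B}"
  \<comment> \<open>Every point of the ball has weight at least 1 under 2 to the power B minus its l1 distance
    to the centre, since the l1 distance of integer points is at most the squared l2 distance.\<close>
  have "1 \<le> 2 ^ B * (\<Prod>t\<in>T. (1 / 2 :: real) ^ ?d (v t) (c t))" if "v \<in> ?A" for v
  proof -
    have "real (?d x y) \<le> (real x - real y)\<^sup>2" for x y
    proof -
      have "\<bar>int x - int y\<bar> \<le> \<bar>int x - int y\<bar> * \<bar>int x - int y\<bar>"
        using mult_right_mono[of 1 "\<bar>int x - int y\<bar>" "\<bar>int x - int y\<bar>"]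
        by (cases "x = y") (simp_all del: abs_mult_self_eq)
      also have "\<dots> = (int x - int y)\<^sup>2" by (simp add: power2_eq_square flip: abs_mult)
      finally have "real_of_int \<bar>int x - int y\<bar> \<le> real_of_int ((int x - int y)\<^sup>2)"
        by linarith
      then show ?thesis by simp
    qed
    then have "(\<Sum>t\<in>T. real (?d (v t) (c t))) \<le> (\<Sum>t\<in>T. (real (v t) - real (c t))\<^sup>2)"
      by (rule sum_mono)
    also have "\<dots> \<le> real B" using that by simp
    finally have "(\<Sum>t\<in>T. real (?d (v t) (c t))) \<le> real B" .
    then have "(\<Sum>t\<in>T. ?d (v t) (c t)) \<le> B"
      by (simp only: of_nat_sum[symmetric] of_nat_le_iff)
    then have "(1 / 2 :: real) ^ B \<le> (1 / 2) ^ (\<Sum>t\<in>T. ?d (v t) (c t))"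
      by (intro power_decreasing) auto
    then have "1 \<le> 2 ^ B * (1 / 2 :: real) ^ (\<Sum>t\<in>T. ?d (v t) (c t))"
      by (simp add: power_one_over field_simps)
    then show ?thesis
      by (simp only: power_sum)
  qed
  then have "(\<Sum>v\<in>?A. 1) \<le> (\<Sum>v\<in>?A. 2 ^ B * (\<Prod>t\<in>T. (1 / 2 :: real) ^ ?d (v t) (c t)))"
    by (intro sum_mono)
  also have "\<dots> \<le> (\<Sum>v\<in>T \<rightarrow>\<^sub>E {..<Q}. 2 ^ B * (\<Prod>t\<in>T. (1 / 2 :: real) ^ ?d (v t) (c t)))"
    using assms by (intro sum_mono2) (auto intro!: finite_PiE mult_nonneg_nonneg prod_nonneg)
  also have "\<dots> = 2 ^ B * (\<Prod>t\<in>T. \<Sum>q<Q. (1 / 2 :: real) ^ ?d q (c t))"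
    using assms by (simp add: sum_distrib_left[symmetric] prod_sum_PiE)
  also have "\<dots> \<le> 2 ^ B * (\<Prod>t\<in>T. 4)"
    using slice by (intro mult_left_mono prod_mono) (auto intro: sum_nonneg)
  finally show ?thesis by simp
qed

text \<open>The bound by \<open>Q\<close> covers every index and position, so amplitudes are
  controlled even for invalid messages; separation concerns only the \<open>M\<close> messages and
  the positions in \<open>T\<close>.\<close>

definition separated_codebook :: "nat \<Rightarrow> nat \<Rightarrow> 't set \<Rightarrow> nat \<Rightarrow> (nat \<Rightarrow> 't \<Rightarrow> nat) \<Rightarrow> bool" where
  "separated_codebook Q B T M f \<longleftrightarrow> (\<forall>i t. f i t < Q) \<and>
     (\<forall>i\<in>{1..M}. \<forall>j\<in>{1..M}. i \<noteq> j \<longrightarrow> real B < (\<Sum>t\<in>T. (real (f i t) - real (f j t))\<^sup>2))"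

text \<open>Greedy (Gilbert--Varshamov) packing.\<close>

lemma separated_codebook_exists:
  assumes "finite T" "0 < Q"
    and "M \<noteq> 0 \<Longrightarrow> real (M - 1) * (2 ^ B * 4 ^ card T) < real Q ^ card T"
  shows "\<exists>f. separated_codebook Q B T M f"
  using assms(3)
proof (induction M)
  case 0
  then show ?case
    using assms(2) by (auto simp: separated_codebook_def intro!: exI[of _ "\<lambda>_ _. 0"])
next
  case (Suc M)
  have "real (M - 1) * (2 ^ B * 4 ^ card T) \<le> real M * (2 ^ B * 4 ^ card T)"
    by (intro mult_right_mono) auto
  also have "\<dots> < real Q ^ card T"
    using Suc.prems by simp
  finally obtain f where f: "separated_codebook Q B T M f"
    using Suc.IH by blast
  let ?ball = "\<lambda>i. {v \<in> T \<rightarrow>\<^sub>E {..<Q}. (\<Sum>t\<in>T. (real (v t) - real (f i t))\<^sup>2) \<le> real B}"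
  \<comment> \<open>The balls around the existing codewords together hold fewer points than the
    grid, so some grid point lies outside all of them.\<close>
  have "real (card (\<Union>i\<in>{1..M}. ?ball i)) \<le> (\<Sum>i\<in>{1..M}. real (card (?ball i)))"
    by (simp only: of_nat_sum[symmetric] of_nat_le_iff) (intro card_UN_le, simp)
  also have "\<dots> \<le> (\<Sum>i\<in>{1..M}. 2 ^ B * 4 ^ card T)"
    by (intro sum_mono card_grid_ball assms)
  also have "\<dots> < real (card (T \<rightarrow>\<^sub>E {..<Q}))"
    using Suc.prems assms(1) by (simp add: card_PiE)
  finally have "\<not> (T \<rightarrow>\<^sub>E {..<Q}) \<subseteq> (\<Union>i\<in>{1..M}. ?ball i)"
    using card_mono[of "\<Union>i\<in>{1..M}. ?ball i" "T \<rightarrow>\<^sub>E {..<Q}"] assms(1)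
    by (force intro: finite_PiE)
  then obtain v where v: "v \<in> T \<rightarrow>\<^sub>E {..<Q}" "\<And>i. i \<in> {1..M} \<Longrightarrow> v \<notin> ?ball i"
    by blast
  \<comment> \<open>\<open>v\<close> has no useful value outside \<open>T\<close>; the default 0
    keeps the new codeword below \<open>Q\<close> there.\<close>
  define f' where "f' = f(Suc M := (\<lambda>t. if t \<in> T then v t else 0))"
  have new: "real B < (\<Sum>t\<in>T. (real (v t) - real (f i t))\<^sup>2)" if "i \<in> {1..M}" for i
    using v that by fastforce
  have new': "real B < (\<Sum>t\<in>T. (real (f i t) - real (v t))\<^sup>2)" if "i \<in> {1..M}" for i
    using new[OF that] by (simp add: power2_commute)
  have "separated_codebook Q B T (Suc M) f'"
    unfolding separated_codebook_def
  proof (intro conjI allI ballI impI)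
    show "f' i t < Q" for i t
      using f v(1) assms(2) by (auto simp: f'_def separated_codebook_def PiE_iff)
  next
    fix i j assume ij: "i \<in> {1..Suc M}" "j \<in> {1..Suc M}" "i \<noteq> j"
    show "real B < (\<Sum>t\<in>T. (real (f' i t) - real (f' j t))\<^sup>2)"
    proof (cases "i = Suc M \<or> j = Suc M")
      case True
      then show ?thesis
        using ij new[of j] new'[of i] by (auto simp: f'_def cong: sum.cong)
    next
      case False
      then have "i \<in> {1..M}" "j \<in> {1..M}" using ij by auto
      then show ?thesis
        using False f ij by (simp add: f'_def separated_codebook_def)
    qed
  qed
  then show ?case by blast
qed

text \<open>The squared radius \<open>B / 4\<close> corresponds to half the minimum
  distance.\<close>

definition ball_decode :: "nat \<Rightarrow> 't set \<Rightarrow> nat \<Rightarrow> (nat \<Rightarrow> 't \<Rightarrow> nat) \<Rightarrow> ('t \<Rightarrow> real) \<Rightarrow> nat" where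
  "ball_decode B T M f v = (LEAST i. i \<in> {1..M} \<and> (\<Sum>t\<in>T. (v t - real (f i t))\<^sup>2) \<le> real B / 4)"

text \<open>Two codewords this close to \<open>v\<close> would have squared distance at most
  \<open>B\<close>, because \<open>(a - b)^2\<close> is at most \<open>2 a^2 + 2 b^2\<close>;
  separation excludes that.\<close>

lemma ball_decode_eq:
  assumes "separated_codebook Q B T M f" "i \<in> {1..M}"
    and "(\<Sum>t\<in>T. (v t - real (f i t))\<^sup>2) \<le> real B / 4"
  shows "ball_decode B T M f v = i"
  unfolding ball_decode_def
proof (rule Least_equality)
  fix j assume j: "j \<in> {1..M} \<and> (\<Sum>t\<in>T. (v t - real (f j t))\<^sup>2) \<le> real B / 4"
  show "i \<le> j"
  proof (rule ccontr)
    assume "\<not> i \<le> j"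
    then have "real B < (\<Sum>t\<in>T. (real (f i t) - real (f j t))\<^sup>2)"
      using assms j by (auto simp: separated_codebook_def)
    also have "\<dots> \<le> (\<Sum>t\<in>T. 2 * (v t - real (f i t))\<^sup>2 + 2 * (v t - real (f j t))\<^sup>2)"
    proof (rule sum_mono)
      fix t
      show "(real (f i t) - real (f j t))\<^sup>2 \<le> 2 * (v t - real (f i t))\<^sup>2 + 2 * (v t - real (f j t))\<^sup>2"
        using zero_le_power2[of "(v t - real (f i t)) + (v t - real (f j t))"]
        by (simp add: power2_eq_square algebra_simps)
    qed
    also have "\<dots> \<le> real B"
      using assms j by (simp add: sum.distrib sum_distrib_left[symmetric])
    finally show False by simp
  qed
qed (use assms in auto)

lemma measurable_ball_decode:
  assumes "\<And>t. (\<lambda>x. v x t) \<in> borel_measurable N"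
  shows "(\<lambda>x. ball_decode B T M f (v x)) \<in> N \<rightarrow>\<^sub>M count_space UNIV"
  using assms unfolding ball_decode_def by measurable


section \<open>Flooding data along shortest paths\<close>

subsection \<open>Relaying\<close>

definition hops :: "('a \<times> 'a) set \<Rightarrow> 'a \<Rightarrow> 'a \<Rightarrow> nat" where
  "hops E j l = (LEAST d. (j, l) \<in> E ^^ d)"

text \<open>The choice depends on the graph alone, so the routes are fixed before any data are
  seen.\<close>

definition prev_hop :: "('a \<times> 'a) set \<Rightarrow> 'a \<Rightarrow> 'a \<Rightarrow> 'a" where
  "prev_hop E j l = (SOME p. (p, l) \<in> E \<and> (j, p) \<in> E ^^ (hops E j l - 1))"

lemma hops_le: "(j, l) \<in> E ^^ d \<Longrightarrow> hops E j l \<le> d"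
  unfolding hops_def by (rule Least_le)

lemma relpow_hops: "(j, l) \<in> E\<^sup>* \<Longrightarrow> (j, l) \<in> E ^^ hops E j l"
  unfolding hops_def by (rule LeastI_ex) (simp add: rtrancl_power)

lemma hops_le_card:
  assumes "finite E" "(j, l) \<in> E\<^sup>*"
  shows "hops E j l \<le> card E"
  using assms rtrancl_finite_eq_relpow[of E] hops_le[of j l _ E] by fastforce

lemma prev_hop:
  assumes "(j, l) \<in> E\<^sup>*" "j \<noteq> l"
  shows "0 < hops E j l" "(prev_hop E j l, l) \<in> E"
    "(j, prev_hop E j l) \<in> E ^^ (hops E j l - 1)"
proof -
  show pos: "0 < hops E j l"
    using relpow_hops[OF assms(1)] assms(2) by (cases "hops E j l") auto
  then obtain d where "hops E j l = Suc d" by (cases "hops E j l") auto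
  then have "\<exists>p. (p, l) \<in> E \<and> (j, p) \<in> E ^^ (hops E j l - 1)"
    using relpow_hops[OF assms(1)] by auto
  from someI_ex[OF this] show "(prev_hop E j l, l) \<in> E"
    "(j, prev_hop E j l) \<in> E ^^ (hops E j l - 1)"
    unfolding prev_hop_def by auto
qed

text \<open>
  In round r, every terminal forwards the datum of terminal r mod (K + 1), taken from the fixed
  neighbour that is one hop closer to the source.  Hence after d (K + 1) rounds a terminal knows
  the data of all terminals at distance at most d.
\<close>

definition relayed ::
  "nat \<Rightarrow> (nat \<times> nat) set \<Rightarrow> nat \<Rightarrow> 'm \<Rightarrow> (nat \<Rightarrow> nat \<Rightarrow> 'm) \<Rightarrow> nat \<Rightarrow> 'm" where
  "relayed K E l v hist j =
     (if j = l then v else hist ((hops E j l - 1) * (K + 1) + j) (prev_hop E j l))"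

lemma coop_history_nth:
  "i < r \<Longrightarrow> coop_history link d f r k i l
     = (if link l k then f i l k (coop_history link d f i l) else d)"
  by (induction r) (auto simp: less_Suc_eq)

lemma relayed_coop_history:
  assumes "(j, l) \<in> E\<^sup>*" "j \<le> K" "hops E j l * (K + 1) \<le> R"
    and "\<And>l k. link l k \<longleftrightarrow> (l, k) \<in> E"
    and "\<And>r l k hist. f r l k hist = relayed K E l (v l) hist (r mod (K + 1))"
  shows "relayed K E l (v l) (coop_history link d f R l) j = v j"
  using assms(1,3)
proof (induction "hops E j l" arbitrary: l R rule: less_induct)
  case less
  show ?case
  proof (cases "j = l")
    case False
    \<comment> \<open>Round \<open>?i\<close> is the one devoted to \<open>j\<close> in block
      \<open>hops E j l - 1\<close>, counted from 0. By then the previous hop has the datum, being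
      at most \<open>hops E j l - 1\<close> hops from \<open>j\<close>.\<close>
    let ?p = "prev_hop E j l" and ?i = "(hops E j l - 1) * (K + 1) + j"
    note p = prev_hop[OF less.prems(1) False]
    have closer: "hops E j ?p \<le> hops E j l - 1"
      using p(3) by (rule hops_le)
    have "hops E j l * (K + 1) = (hops E j l - 1) * (K + 1) + (K + 1)"
      using p(1) by (cases "hops E j l") auto
    then have i: "?i < R" using less.prems(2) assms(2) by linarith
    have "?i mod (K + 1) = j"
      using assms(2) by (simp only: mod_mult_self3) simp
    then have "relayed K E l (v l) (coop_history link d f R l) j
        = relayed K E ?p (v ?p) (coop_history link d f ?i ?p) j"
      using False p(2) by (simp only: relayed_def[of K E l] coop_history_nth[OF i] assms(4,5) if_True if_False)
    also have "\<dots> = v j"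
    proof (rule less.hyps)
      show "hops E j ?p < hops E j l" using closer p(1) by linarith
      show "(j, ?p) \<in> E\<^sup>*" using p(3) by (rule relpow_imp_rtrancl)
      show "hops E j ?p * (K + 1) \<le> ?i"
        using mult_right_mono[OF closer, of "K + 1"] by linarith
    qed
    finally show ?thesis .
  qed (simp add: relayed_def)
qed

section \<open>Colouring, connected components and zero forcers\<close>

subsection \<open>The network\<close>

lemma finite_hex_neighbours [simp]: "finite (hex_neighbours K pos k)"
  by (simp add: hex_neighbours_def)

lemma finite_active_set [simp]: "finite (active_set K s)"
  by (simp add: active_set_def)

lemma finite_urllc_set [simp]: "finite (urllc_set K s)"
  by (simp add: urllc_set_def)

lemma urllc_set_subset: "urllc_set K s \<subseteq> active_set K s"
  by (auto simp: urllc_set_def active_set_def)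

lemma active_set_subset: "active_set K s \<subseteq> {1..K}"
  by (auto simp: active_set_def)

lemma hex_neighbours_subset: "hex_neighbours K pos k \<subseteq> {1..K}"
  by (auto simp: hex_neighbours_def)

lemma hex_neighbours_sym:
  assumes "j \<in> hex_neighbours K pos k" "k \<in> {1..K}"
  shows "k \<in> hex_neighbours K pos j"
proof -
  have "(- a, - b) \<in> {(1, 0), (-1, 0), (0, 1), (0, -1), (1, 1), (-1, -1 :: int)}"
    if "(a, b) \<in> {(1 :: int, 0), (-1, 0), (0, 1), (0, -1), (1, 1), (-1, -1)}" for a b :: int
    using that by auto
  from this[of "fst (pos k) - fst (pos j)" "snd (pos k) - snd (pos j)"] show ?thesis
    using assms unfolding hex_neighbours_def mem_Collect_eq minus_diff_eq by blast
qed

lemma hex_neighbours_irrefl [simp]: "k \<notin> hex_neighbours K pos k"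
  by (simp add: hex_neighbours_def)

text \<open>All six neighbour offsets change the coordinate sum by 1 or 2 up to sign, never by a
  multiple of 3, so this is a proper 3-colouring.\<close>

definition hex_colour :: "(nat \<Rightarrow> int \<times> int) \<Rightarrow> nat \<Rightarrow> nat" where
  "hex_colour pos k = nat ((fst (pos k) + snd (pos k)) mod 3)"

lemma hex_colour_less: "hex_colour pos k < 3"
  unfolding hex_colour_def by (simp add: nat_less_iff)

lemma hex_colour_neighbours:
  assumes "j \<in> hex_neighbours K pos k"
  shows "hex_colour pos j \<noteq> hex_colour pos k"
proof -
  define a b where "a = fst (pos k) + snd (pos k)" and "b = fst (pos j) + snd (pos j)"
  have "a - b \<in> {1, -1, 2, -2}"
    using assms by (auto simp: hex_neighbours_def a_def b_def)
  then have "a mod 3 \<noteq> b mod 3" by auto presburger+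
  then show ?thesis
    by (simp add: hex_colour_def a_def b_def eq_nat_nat_iff)
qed

definition phase :: "nat \<Rightarrow> nat \<Rightarrow> nat set" where
  "phase len c = {c * len + 1..c * len + len}"

lemma phase_disjoint:
  assumes "c \<noteq> d"
  shows "phase len c \<inter> phase len d = {}"
proof -
  have "phase len c \<inter> phase len d = {}" if "c < d" for c d
    using mult_le_mono1[of "Suc c" d len] that by (auto simp: phase_def)
  then show ?thesis using assms by (metis Int_commute linorder_neq_iff)
qed

lemma phase_subset:
  assumes "c < 3" "3 * len \<le> n"
  shows "phase len c \<subseteq> {1..n}"
proof -
  have "Suc c * len \<le> 3 * len" using assms(1) by (intro mult_le_mono1) simp
  then have "c * len + len \<le> n" using assms(2) unfolding mult_Suc by linarith
  then show ?thesis by (auto simp: phase_def)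
qed

locale hex_network =
  fixes K :: nat and pos :: "nat \<Rightarrow> int \<times> int" and h :: "nat \<Rightarrow> nat \<Rightarrow> real"
  assumes generic: "generic_gains K pos h"
begin

lemma direct_gain_nonzero:
  assumes "k \<in> {1..K}"
  shows "h k k \<noteq> 0"
proof
  assume "h k k = 0"
  then have "\<forall>j\<in>{k}. (1::real) = 0"
    using generic[unfolded generic_gains_def, rule_format, of "{k}" "\<lambda>_. 1"] assms
    by (simp add: channel_gain_def)
  then show False by simp
qed

text \<open>The rows of a left inverse of the channel matrix of \<open>S\<close>: row
  \<open>j\<close> isolates the input of cell \<open>j\<close> from the outputs of
  \<open>S\<close>.\<close>

definition zero_forcer :: "nat set \<Rightarrow> nat \<Rightarrow> nat \<Rightarrow> real" where
  "zero_forcer S = (SOME g. \<forall>j\<in>S. \<forall>i\<in>S.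
     (\<Sum>k\<in>S. g j k * channel_gain K pos h i k) = of_bool (i = j))"

lemma zero_forcer:
  assumes "S \<subseteq> {1..K}" "j \<in> S" "i \<in> S"
  shows "(\<Sum>k\<in>S. zero_forcer S j k * channel_gain K pos h i k) = of_bool (i = j)"
proof -
  have "finite S" using assms(1) by (rule finite_subset) simp
  then have "\<exists>g. \<forall>j\<in>S. \<forall>i\<in>S. (\<Sum>k\<in>S. g j k * channel_gain K pos h i k) = of_bool (i = j)"
    using assms(1) generic
    by (intro left_inverse_of_trivial_kernel) (auto simp: generic_gains_def)
  from someI_ex[OF this] show ?thesis
    using assms(2,3) unfolding zero_forcer_def by blast
qed

definition links :: "activity \<Rightarrow> (nat \<times> nat) set" where
  "links s = {(l, k). coop_link K pos s l k}"

text \<open>The cells whose outputs can reach Rx \<open>k\<close>. Links are symmetric, so this is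
  the connected component of \<open>k\<close>.\<close>

definition component :: "activity \<Rightarrow> nat \<Rightarrow> nat set" where
  "component s k = {j. (j, k) \<in> (links s)\<^sup>*}"

lemma links_subset: "links s \<subseteq> active_set K s \<times> active_set K s"
  by (auto simp: links_def coop_link_def)

lemma finite_links: "finite (links s)"
  by (rule finite_subset[OF links_subset]) simp

lemma card_links_le: "card (links s) \<le> K * K"
proof -
  have "card (links s) \<le> card ({1..K} \<times> {1..K})"
    using links_subset[of s] active_set_subset[of K s] by (intro card_mono) auto
  then show ?thesis by simp
qed

lemma component_subset: "k \<in> active_set K s \<Longrightarrow> component s k \<subseteq> active_set K s"
  using links_subset[of s] unfolding component_def
  by (auto elim: converse_rtranclE)

lemma component_self: "k \<in> component s k"
  by (simp add: component_def)

text \<open>Active interferers are linked cells, so no interference enters a component from outside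
  and its channel is a closed square system.\<close>

lemma component_closed:
  assumes "l \<in> component s k" "k \<in> active_set K s" "j \<in> hex_neighbours K pos l" "j \<in> active_set K s"
  shows "j \<in> component s k"
proof -
  have l: "l \<in> active_set K s" using component_subset assms(1,2) by blast
  then have "l \<in> hex_neighbours K pos j"
    using hex_neighbours_sym[OF assms(3)] active_set_subset by blast
  then have "(j, l) \<in> links s" using l assms(4) by (simp add: links_def coop_link_def)
  then show ?thesis using assms(1) unfolding component_def
    by (auto intro: converse_rtrancl_into_rtrancl)
qed

text \<open>Precancelling the interference of the neighbours amplifies the input by at most this factor.\<close>

definition input_growth :: real where
  "input_growth = 1 + (\<Sum>k\<in>{1..K}. \<Sum>j\<in>{1..K}. \<bar>h j k / h k k\<bar>)"

text \<open>
  Bounds the energy of the noise after division by the direct gain, or after zero forcing, in terms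
  of the total noise energy.
\<close>

definition noise_growth :: real where
  "noise_growth = (\<Sum>k\<in>{1..K}. (1 / h k k)\<^sup>2)
     + (\<Sum>S\<in>Pow {1..K}. \<Sum>j\<in>S. \<Sum>l\<in>S. (zero_forcer S j l)\<^sup>2)"

lemma input_growth_ge_1: "1 \<le> input_growth"
  unfolding input_growth_def by (auto intro!: sum_nonneg)

lemma noise_growth_nonneg: "0 \<le> noise_growth"
  unfolding noise_growth_def by (auto intro!: add_nonneg_nonneg sum_nonneg)

lemma direct_noise_growth:
  assumes "k \<in> {1..K}"
  shows "(1 / h k k)\<^sup>2 \<le> noise_growth"
proof -
  have "(1 / h k k)\<^sup>2 \<le> (\<Sum>k\<in>{1..K}. (1 / h k k)\<^sup>2)"
    using assms by (intro member_le_sum) auto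
  moreover have "0 \<le> (\<Sum>S\<in>Pow {1..K}. \<Sum>j\<in>S. \<Sum>l\<in>S. (zero_forcer S j l)\<^sup>2)"
    by (auto intro!: sum_nonneg)
  ultimately show ?thesis by (simp add: noise_growth_def)
qed

lemma zero_forcing_noise_growth:
  assumes "S \<subseteq> {1..K}" "j \<in> S"
  shows "(\<Sum>l\<in>S. (zero_forcer S j l)\<^sup>2) \<le> noise_growth"
proof -
  have fin: "finite S" using assms(1) by (rule finite_subset) simp
  have "(\<Sum>l\<in>S. (zero_forcer S j l)\<^sup>2) \<le> (\<Sum>j\<in>S. \<Sum>l\<in>S. (zero_forcer S j l)\<^sup>2)"
    using assms fin by (intro member_le_sum) (auto intro!: sum_nonneg)
  also have "\<dots> \<le> (\<Sum>S\<in>Pow {1..K}. \<Sum>j\<in>S. \<Sum>l\<in>S. (zero_forcer S j l)\<^sup>2)"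
    using assms by (intro member_le_sum) (auto intro!: sum_nonneg)
  moreover have "0 \<le> (\<Sum>k\<in>{1..K}. (1 / h k k)\<^sup>2)"
    by (auto intro!: sum_nonneg)
  ultimately show ?thesis by (simp add: noise_growth_def)
qed

end


section \<open>The code, its signals and its decoding radius\<close>

subsection \<open>The coding scheme\<close>

text \<open>The zero codebook is the fallback for blocklengths without a separated one: power is
  constrained at every \<open>n\<close>, while reliability matters only in the limit.\<close>

definition codebook :: "nat \<Rightarrow> nat \<Rightarrow> 't set \<Rightarrow> nat \<Rightarrow> nat \<Rightarrow> 't \<Rightarrow> nat" where
  "codebook Q B T M =
     (if \<exists>f. separated_codebook Q B T M f then SOME f. separated_codebook Q B T M f else (\<lambda>_ _. 0))"

lemma separated_codebook_codebook:
  "\<exists>f. separated_codebook Q B T M f \<Longrightarrow> separated_codebook Q B T M (codebook Q B T M)"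
  using someI_ex[of "separated_codebook Q B T M"] by (auto simp: codebook_def)

lemma codebook_less:
  assumes "0 < Q"
  shows "codebook Q B T M i t < Q"
proof (cases "\<exists>f. separated_codebook Q B T M f")
  case True
  from separated_codebook_codebook[OF this] show ?thesis
    by (simp add: separated_codebook_def)
qed (use assms in \<open>simp add: codebook_def\<close>)

text \<open>\<open>Q\<close> is the number of amplitude levels and \<open>B\<close> the squared
  separation of codewords; the bound on \<alpha> lets three phases fit into a block.\<close>

locale hex_scheme = hex_network +
  fixes \<alpha> RU :: real and RE :: "activity \<Rightarrow> nat \<Rightarrow> real" and n Q B :: nat
  assumes \<alpha>: "0 \<le> \<alpha>" "\<alpha> \<le> 1 / 3"
    and Q_pos: "0 < Q"
begin

definition U_slots :: "nat \<Rightarrow> nat set" where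
  "U_slots k = phase (nat \<lfloor>\<alpha> * real n\<rfloor>) (hex_colour pos k)"

definition E_slots :: "activity \<Rightarrow> nat \<Rightarrow> nat set" where
  "E_slots s k = {1..n} - (if k \<in> urllc_set K s then U_slots k else {})"

abbreviation U_count :: nat where
  "U_count \<equiv> message_count n RU"

abbreviation E_count :: "activity \<Rightarrow> nat \<Rightarrow> nat" where
  "E_count s k \<equiv> message_count n (RE s k)"

definition U_book :: "nat \<Rightarrow> nat \<Rightarrow> nat \<Rightarrow> nat" where
  "U_book k = codebook Q B (U_slots k) U_count"

definition E_book :: "activity \<Rightarrow> nat \<Rightarrow> nat \<Rightarrow> nat \<Rightarrow> nat" where
  "E_book s k = codebook Q B (E_slots s k) (E_count s k)"

text \<open>The entry \<open>hist 0 j\<close> is the eMBB message of neighbour \<open>j\<close>.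
  Dividing by \<open>h k k\<close> makes the subtracted sum reach Rx \<open>k\<close> as the
  negative of the interference.\<close>

definition scheme :: code where
  "scheme = \<lparr>
     tx_coop = (\<lambda>s r l k me hist. me),
     encode = (\<lambda>s k mu me hist t.
       if k \<in> urllc_set K s \<and> t \<in> U_slots k
       then real (U_book k mu t) - (\<Sum>j\<in>hex_neighbours K pos k \<inter> active_set K s.
              h j k / h k k * real (E_book s j (hist 0 j) t))
       else real (E_book s k me t)),
     decode_urllc = (\<lambda>s k y. ball_decode B (U_slots k) U_count (U_book k) (\<lambda>t. y t / h k k)),
     rx_coop = (\<lambda>s r l k y hist. relayed K (links s) l y hist (r mod (K + 1))),
     decode_embb = (\<lambda>s k y hist. ball_decode B (E_slots s k) (E_count s k) (E_book s k)
       (\<lambda>t. \<Sum>l\<in>component s k. zero_forcer (component s k) k l * relayed K (links s) k y hist l t))\<rparr>"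

lemma U_slots_subset: "U_slots k \<subseteq> {1..n}"
proof -
  have "real (nat \<lfloor>\<alpha> * real n\<rfloor>) \<le> \<alpha> * real n"
    using \<alpha> by simp
  also have "\<dots> \<le> 1 / 3 * real n"
    using \<alpha> by (intro mult_right_mono) auto
  finally have "3 * nat \<lfloor>\<alpha> * real n\<rfloor> \<le> n" by linarith
  then show ?thesis unfolding U_slots_def using hex_colour_less by (rule phase_subset[rotated])
qed

lemma finite_U_slots [simp]: "finite (U_slots k)"
  by (simp add: U_slots_def phase_def)

lemma finite_E_slots [simp]: "finite (E_slots s k)"
  by (simp add: E_slots_def)

lemma E_slots_subset: "E_slots s k \<subseteq> {1..n}"
  by (auto simp: E_slots_def)

lemma card_U_slots: "card (U_slots k) = nat \<lfloor>\<alpha> * real n\<rfloor>"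
  by (simp add: U_slots_def phase_def)

lemma card_E_slots:
  "card (E_slots s k) = (if k \<in> urllc_set K s then n - nat \<lfloor>\<alpha> * real n\<rfloor> else n)"
  using U_slots_subset by (simp add: E_slots_def card_Diff_subset card_U_slots)

lemma U_slots_disjoint:
  "j \<in> hex_neighbours K pos k \<Longrightarrow> U_slots j \<inter> U_slots k = {}"
  unfolding U_slots_def by (intro phase_disjoint hex_colour_neighbours)

lemma U_book_less: "U_book k i t < Q"
  unfolding U_book_def using Q_pos by (rule codebook_less)

lemma E_book_less: "E_book s k i t < Q"
  unfolding E_book_def using Q_pos by (rule codebook_less)

lemma measurable_relayed:
  "(\<lambda>(y, hist). relayed K E l y hist j) \<in> (borel \<Otimes>\<^sub>M borel :: ((nat \<Rightarrow> real) \<times> (nat \<Rightarrow> nat \<Rightarrow> nat \<Rightarrow> real)) measure) \<rightarrow>\<^sub>M borel"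
proof (cases "j = l")
  case False
  have "(\<lambda>x :: (nat \<Rightarrow> real) \<times> (nat \<Rightarrow> nat \<Rightarrow> nat \<Rightarrow> real). snd x a b) \<in> borel \<Otimes>\<^sub>M borel \<rightarrow>\<^sub>M borel" for a b
    by (rule measurable_compose[OF measurable_compose[OF measurable_snd
          measurable_product_coordinates] measurable_product_coordinates])
  then show ?thesis using False by (simp add: relayed_def case_prod_beta')
qed (simp add: relayed_def)

lemma measurable_scheme: "measurable_code scheme"
  unfolding measurable_code_def
proof (intro conjI allI)
  show "decode_urllc scheme s k \<in> borel \<rightarrow>\<^sub>M count_space UNIV" for s k
    unfolding scheme_def by (simp, rule measurable_ball_decode) simp
  show "case_prod (rx_coop scheme s r l k) \<in> borel \<Otimes>\<^sub>M borel \<rightarrow>\<^sub>M borel" for s r l k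
    unfolding scheme_def using measurable_relayed by simp
  show "case_prod (decode_embb scheme s k) \<in> borel \<Otimes>\<^sub>M borel \<rightarrow>\<^sub>M count_space UNIV" for s k
  proof -
    have "(\<lambda>x :: (nat \<Rightarrow> real) \<times> (nat \<Rightarrow> nat \<Rightarrow> nat \<Rightarrow> real). relayed K (links s) k (fst x) (snd x) l t)
      \<in> borel_measurable (borel \<Otimes>\<^sub>M borel)" for l and t :: nat
      using measurable_compose[OF measurable_relayed[of "links s" k l], of "\<lambda>y. y t" borel]
      by (simp add: case_prod_beta')
    then show ?thesis
      unfolding scheme_def case_prod_beta' code.simps
      by (intro measurable_ball_decode borel_measurable_sum borel_measurable_times
          borel_measurable_const)
  qed
qed

section \<open>Signals for fixed activity and messages\<close>

context
  fixes s :: activity and m :: messages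
begin

abbreviation "input \<equiv> channel_input K pos (Suc 0) scheme s m"

lemma input_E:
  assumes "k \<in> active_set K s" "k \<in> urllc_set K s \<Longrightarrow> t \<notin> U_slots k"
  shows "input k t = real (E_book s k (snd m k) t)"
  using assms by (auto simp: channel_input_def scheme_def)

lemma input_inactive: "k \<notin> active_set K s \<Longrightarrow> input k t = 0"
  by (simp add: channel_input_def)

lemma input_U:
  assumes "k \<in> urllc_set K s" "t \<in> U_slots k"
  shows "input k t = real (U_book k (fst m k) t)
    - (\<Sum>j\<in>hex_neighbours K pos k \<inter> active_set K s. h j k / h k k * real (E_book s j (snd m j) t))"
proof -
  have k: "k \<in> active_set K s" "k \<in> {1..K}"
    using assms(1) urllc_set_subset active_set_subset by blast+
  \<comment> \<open>These links exist, so the history holds the eMBB message of \<open>j\<close> and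
    not the default 0.\<close>
  have link: "coop_link K pos s j k" if "j \<in> hex_neighbours K pos k \<inter> active_set K s" for j
    using that k hex_neighbours_sym by (auto simp: coop_link_def)
  show ?thesis
    using assms k by (auto simp: channel_input_def scheme_def link intro!: sum.cong)
qed

text \<open>Codebook entries are at most \<open>Q - 1\<close>, and precancelling adds at most the
  sum of the gain ratios times \<open>Q - 1\<close>.\<close>

lemma abs_input_le: "\<bar>input k t\<bar> \<le> input_growth * (real Q - 1)"
proof -
  have Q1: "0 \<le> real Q - 1" using Q_pos by simp
  have U1: "real (U_book k i t) \<le> real Q - 1" and E1: "real (E_book s k i t) \<le> real Q - 1" for k i t
    using U_book_less[of k i t] E_book_less[of s k i t] by linarith+
  have small: "real Q - 1 \<le> input_growth * (real Q - 1)"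
    using input_growth_ge_1 Q1 by (simp add: mult_le_cancel_right1)
  consider "k \<notin> active_set K s" | "k \<in> urllc_set K s" "t \<in> U_slots k"
    | "k \<in> active_set K s" "k \<in> urllc_set K s \<Longrightarrow> t \<notin> U_slots k"
    using urllc_set_subset by blast
  then show ?thesis
  proof cases
    case 1
    then show ?thesis using small Q1 by (simp add: input_inactive)
  next
    case 2
    let ?N = "hex_neighbours K pos k \<inter> active_set K s"
    have k: "k \<in> {1..K}" using 2 by (simp add: urllc_set_def)
    have "\<bar>input k t\<bar> \<le> \<bar>real (U_book k (fst m k) t)\<bar>
        + \<bar>\<Sum>j\<in>?N. h j k / h k k * real (E_book s j (snd m j) t)\<bar>"
      unfolding input_U[OF 2] by (rule abs_triangle_ineq4)
    also have "\<dots> \<le> (real Q - 1) + (\<Sum>j\<in>?N. \<bar>h j k / h k k * real (E_book s j (snd m j) t)\<bar>)"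
      using U1 by (intro add_mono sum_abs) simp
    also have "(\<Sum>j\<in>?N. \<bar>h j k / h k k * real (E_book s j (snd m j) t)\<bar>)
        \<le> (\<Sum>j\<in>?N. \<bar>h j k / h k k\<bar> * (real Q - 1))"
      by (intro sum_mono) (simp only: abs_mult abs_of_nat, intro mult_left_mono E1 abs_ge_zero)
    also have "\<dots> \<le> (\<Sum>j\<in>{1..K}. \<bar>h j k / h k k\<bar> * (real Q - 1))"
      using Q1 hex_neighbours_subset by (intro sum_mono2) auto
    also have "\<dots> \<le> (\<Sum>k\<in>{1..K}. \<Sum>j\<in>{1..K}. \<bar>h j k / h k k\<bar> * (real Q - 1))"
      using Q1 k by (intro member_le_sum[of k _ "\<lambda>k. \<Sum>j\<in>{1..K}. \<bar>h j k / h k k\<bar> * (real Q - 1)"])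
        (auto intro!: sum_nonneg)
    also have "(real Q - 1) + \<dots> = input_growth * (real Q - 1)"
      by (simp only: input_growth_def sum_distrib_right distrib_right mult_1_left)
    finally show ?thesis by simp
  next
    case 3
    then show ?thesis using E1[of k "snd m k" t] small by (simp add: input_E)
  qed
qed

context
  fixes z :: "nat \<times> nat \<Rightarrow> real"
begin

abbreviation "output \<equiv> channel_output K pos h n input z"

text \<open>By the colouring, no neighbour is in its own URLLC phase at such a time, so each active
  one sends exactly the eMBB symbol that Tx \<open>k\<close> has precancelled.\<close>

lemma output_U:
  assumes "k \<in> urllc_set K s" "t \<in> U_slots k"
  shows "output k t / h k k = real (U_book k (fst m k) t) + 1 / h k k * z (k, t)"
proof -
  have k: "k \<in> {1..K}" using assms(1) by (simp add: urllc_set_def)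
  have t: "t \<in> {1..n}" using U_slots_subset assms(2) by blast
  have "(\<Sum>j\<in>hex_neighbours K pos k. h j k * input j t)
      = (\<Sum>j\<in>hex_neighbours K pos k \<inter> active_set K s. h j k * input j t)"
    by (rule sum.mono_neutral_right) (auto simp: input_inactive)
  also have "\<dots> = (\<Sum>j\<in>hex_neighbours K pos k \<inter> active_set K s. h j k * real (E_book s j (snd m j) t))"
    using U_slots_disjoint assms(2) by (intro sum.cong refl) (subst input_E, auto)
  finally show ?thesis
    using t direct_gain_nonzero[OF k]
    by (simp add: channel_output_def input_U[OF assms] field_simps sum_divide_distrib[symmetric])
qed

lemma output_component:
  assumes "k \<in> active_set K s" "l \<in> component s k" "t \<in> {1..n}"
  shows "output l t = (\<Sum>j\<in>component s k. channel_gain K pos h j l * input j t) + z (l, t)"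
proof -
  have l: "l \<in> active_set K s" "l \<in> {1..K}"
    using component_subset[OF assms(1)] assms(2) active_set_subset by blast+
  have fin: "finite (component s k)"
    using component_subset[OF assms(1)] by (rule finite_subset) simp
  have "h l l * input l t + (\<Sum>j\<in>hex_neighbours K pos l. h j l * input j t)
      = (\<Sum>j\<in>insert l (hex_neighbours K pos l). channel_gain K pos h j l * input j t)"
    by (simp add: channel_gain_def)
  also have "\<dots> = (\<Sum>j\<in>component s k. channel_gain K pos h j l * input j t)"
  \<comment> \<open>Cells dropped on the left are inactive, since active interferers lie in the
    component; cells added on the right have gain 0.\<close>
  proof (rule sum.mono_neutral_cong)
    fix j assume "j \<in> insert l (hex_neighbours K pos l) - component s k"
    then have "j \<notin> active_set K s"
      using component_closed[OF assms(2,1)] assms(2) by blast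
    then show "channel_gain K pos h j l * input j t = 0"
      by (simp add: input_inactive)
  qed (use fin in \<open>auto simp: channel_gain_def\<close>)
  finally show ?thesis using assms(3) by (simp add: channel_output_def)
qed

text \<open>The inversion separates arbitrary inputs, so the URLLC symbols of the other cells,
  precancelled or not, disappear like their eMBB symbols.\<close>

lemma zero_forcing:
  assumes "k \<in> active_set K s" "t \<in> {1..n}"
  defines "S \<equiv> component s k"
  shows "(\<Sum>l\<in>S. zero_forcer S k l * output l t) = input k t + (\<Sum>l\<in>S. zero_forcer S k l * z (l, t))"
proof -
  have S: "S \<subseteq> {1..K}"
    using component_subset[OF assms(1)] active_set_subset unfolding S_def by blast
  then have fin: "finite S" by (rule finite_subset) simp
  have "(\<Sum>l\<in>S. zero_forcer S k l * output l t)
      = (\<Sum>l\<in>S. zero_forcer S k l * (\<Sum>j\<in>S. channel_gain K pos h j l * input j t) + zero_forcer S k l * z (l, t))"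
    using assms(1,2) by (intro sum.cong refl) (simp add: S_def output_component algebra_simps)
  also have "\<dots> = (\<Sum>l\<in>S. \<Sum>j\<in>S. zero_forcer S k l * channel_gain K pos h j l * input j t)
      + (\<Sum>l\<in>S. zero_forcer S k l * z (l, t))"
    by (simp add: sum.distrib sum_distrib_left mult.assoc)
  also have "(\<Sum>l\<in>S. \<Sum>j\<in>S. zero_forcer S k l * channel_gain K pos h j l * input j t)
      = (\<Sum>j\<in>S. (\<Sum>l\<in>S. zero_forcer S k l * channel_gain K pos h j l) * input j t)"
    by (subst sum.swap) (simp add: sum_distrib_right)
  also have "\<dots> = (\<Sum>j\<in>S. of_bool (j = k) * input j t)"
    using zero_forcer[OF S] component_self[of k s] by (intro sum.cong) (auto simp: S_def)
  also have "\<dots> = input k t"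
    using fin component_self[of k s]
    by (simp add: S_def of_bool_def if_distrib[of "\<lambda>x. x * _"] cong: if_cong)
  finally show ?thesis .
qed

abbreviation "received \<equiv> coop_history (coop_link K pos s) (\<lambda>_. 0)
  (\<lambda>r l k. rx_coop scheme s r l k (output l)) ((K * K + 1) * (K + 1))"

text \<open>Distances are at most the number of links, hence at most \<open>K * K\<close>, and each
  hop costs \<open>K + 1\<close> rounds; this fixes the number of Rx-cooperation rounds.\<close>

lemma relayed_received:
  assumes "k \<in> active_set K s" "l \<in> component s k"
  shows "relayed K (links s) k (output k) (received k) l = output l"
proof (rule relayed_coop_history)
  show "l \<le> K"
    using component_subset[OF assms(1)] assms(2) active_set_subset[of K s] by fastforce
  show path: "(l, k) \<in> (links s)\<^sup>*" using assms(2) by (simp add: component_def)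
  have "hops (links s) l k \<le> K * K + 1"
    using hops_le_card[OF finite_links path] card_links_le[of s] by linarith
  then show "hops (links s) l k * (K + 1) \<le> (K * K + 1) * (K + 1)"
    by (rule mult_le_mono1)
qed (simp_all add: links_def scheme_def)

text \<open>Division by the direct gain and zero forcing raise the noise energy by at most
  \<open>noise_growth\<close>, so \<open>noise\<close> keeps every decoder within its
  radius.\<close>

lemma not_decoding_error:
  assumes U: "\<And>k. k \<in> urllc_set K s \<Longrightarrow>
      separated_codebook Q B (U_slots k) U_count (U_book k) \<and> fst m k \<in> {1..U_count}"
    and E: "\<And>k. k \<in> active_set K s \<Longrightarrow>
      separated_codebook Q B (E_slots s k) (E_count s k) (E_book s k) \<and> snd m k \<in> {1..E_count s k}"
    and noise: "noise_growth * (\<Sum>i\<in>{1..K} \<times> {1..n}. (z i)\<^sup>2) \<le> real B / 4"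
  shows "\<not> decoding_error K pos h (Suc 0) ((K * K + 1) * (K + 1)) n scheme s m z"
proof -
  have energy: "(\<Sum>t\<in>T. \<Sum>l\<in>S. (z (l, t))\<^sup>2) \<le> (\<Sum>i\<in>{1..K} \<times> {1..n}. (z i)\<^sup>2)"
    if "S \<subseteq> {1..K}" "T \<subseteq> {1..n}" for S T
  proof -
    have "(\<Sum>t\<in>T. \<Sum>l\<in>S. (z (l, t))\<^sup>2) = (\<Sum>i\<in>S \<times> T. (z i)\<^sup>2)"
      by (subst sum.swap) (simp add: sum.cartesian_product)
    also have "\<dots> \<le> (\<Sum>i\<in>{1..K} \<times> {1..n}. (z i)\<^sup>2)"
      using that by (intro sum_mono2) auto
    finally show ?thesis .
  qed
  have "decode_urllc scheme s k (output k) = fst m k" if k: "k \<in> urllc_set K s" for k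
  proof -
    have k': "k \<in> {1..K}" using k by (simp add: urllc_set_def)
    have "(\<Sum>t\<in>U_slots k. (output k t / h k k - real (U_book k (fst m k) t))\<^sup>2)
        = (\<Sum>t\<in>U_slots k. (1 / h k k)\<^sup>2 * (z (k, t))\<^sup>2)"
      by (intro sum.cong refl) (simp add: output_U[OF k] power_divide)
    also have "\<dots> = (1 / h k k)\<^sup>2 * (\<Sum>t\<in>U_slots k. \<Sum>l\<in>{k}. (z (l, t))\<^sup>2)"
      by (simp add: sum_distrib_left)
    also have "\<dots> \<le> noise_growth * (\<Sum>i\<in>{1..K} \<times> {1..n}. (z i)\<^sup>2)"
      using direct_noise_growth[OF k'] k' U_slots_subset noise_growth_nonneg
      by (intro mult_mono energy) (auto intro!: sum_nonneg)
    also note noise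
    finally have "ball_decode B (U_slots k) U_count (U_book k) (\<lambda>t. output k t / h k k) = fst m k"
      by (rule ball_decode_eq[OF conjunct1[OF U[OF k]] conjunct2[OF U[OF k]]])
    then show ?thesis by (simp add: scheme_def)
  qed
  moreover have "decode_embb scheme s k (output k) (received k) = snd m k"
    if k: "k \<in> active_set K s" for k
  proof -
    let ?S = "component s k"
    let ?g = "zero_forcer ?S k"
    have S: "?S \<subseteq> {1..K}" using component_subset[OF k] active_set_subset by blast
    have "(\<Sum>t\<in>E_slots s k. ((\<Sum>l\<in>?S. ?g l * output l t) - real (E_book s k (snd m k) t))\<^sup>2)
        = (\<Sum>t\<in>E_slots s k. (\<Sum>l\<in>?S. ?g l * z (l, t))\<^sup>2)"
    proof (intro sum.cong refl)
      fix t assume t: "t \<in> E_slots s k"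
      then have "input k t = real (E_book s k (snd m k) t)"
        using k by (intro input_E) (auto simp: E_slots_def)
      then show "((\<Sum>l\<in>?S. ?g l * output l t) - real (E_book s k (snd m k) t))\<^sup>2
          = (\<Sum>l\<in>?S. ?g l * z (l, t))\<^sup>2"
        using zero_forcing[OF k] t E_slots_subset[of s k] by (simp add: subset_iff)
    qed
    \<comment> \<open>Cauchy-Schwarz separates the zero-forcing coefficients, which do not depend on
      time, from the noise.\<close>
    also have "\<dots> \<le> (\<Sum>t\<in>E_slots s k. (\<Sum>l\<in>?S. (?g l)\<^sup>2) * (\<Sum>l\<in>?S. (z (l, t))\<^sup>2))"
      by (intro sum_mono Cauchy_Schwarz_ineq_sum)
    also have "\<dots> = (\<Sum>l\<in>?S. (?g l)\<^sup>2) * (\<Sum>t\<in>E_slots s k. \<Sum>l\<in>?S. (z (l, t))\<^sup>2)"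
      by (simp add: sum_distrib_left)
    also have "\<dots> \<le> noise_growth * (\<Sum>i\<in>{1..K} \<times> {1..n}. (z i)\<^sup>2)"
      using zero_forcing_noise_growth[OF S component_self] S E_slots_subset noise_growth_nonneg
      by (intro mult_mono energy) (auto intro!: sum_nonneg)
    also note noise
    finally have "ball_decode B (E_slots s k) (E_count s k) (E_book s k)
        (\<lambda>t. \<Sum>l\<in>?S. ?g l * output l t) = snd m k"
      by (rule ball_decode_eq[OF conjunct1[OF E[OF k]] conjunct2[OF E[OF k]]])
    moreover have "decode_embb scheme s k y hist = ball_decode B (E_slots s k) (E_count s k) (E_book s k)
        (\<lambda>t. \<Sum>l\<in>?S. ?g l * relayed K (links s) k y hist l t)" for y hist
      by (simp add: scheme_def)
    ultimately show ?thesis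
      using relayed_received[OF k] by (simp cong: sum.cong)
  qed
  ultimately show ?thesis
    unfolding decoding_error_def embb_set_def Let_def by blast
qed

end

end

end

section \<open>Power, error probability and average rates\<close>

subsection \<open>Rates\<close>

lemma expectation_le_const:
  assumes "\<And>x. x \<in> set_pmf p \<Longrightarrow> f x \<le> (c :: real)" "\<And>x. 0 \<le> f x"
  shows "measure_pmf.expectation p f \<le> c"
proof (rule measure_pmf.integral_le_const)
  show "integrable (measure_pmf p) f"
    using assms by (intro measure_pmf.integrable_const_bound[of _ c]) (auto simp: AE_measure_pmf_iff)
qed (use assms in \<open>auto simp: AE_measure_pmf_iff\<close>)

lemma message_count_pos: "0 \<le> R \<Longrightarrow> 0 < message_count n R"
  using ge_one_powr_ge_zero[of 2 "real n * R"] by (simp add: message_count_def)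

lemma message_count_zero: "message_count n 0 = 1"
  by (simp add: message_count_def)

lemma messages_range:
  assumes "m \<in> set_pmf (messages_pmf K n RU RE s)" "0 \<le> RU" "\<And>k. k \<in> {1..K} \<Longrightarrow> 0 \<le> RE s k"
  shows "k \<in> urllc_set K s \<Longrightarrow> fst m k \<in> {1..message_count n RU}"
    and "k \<in> active_set K s \<Longrightarrow> snd m k \<in> {1..message_count n (RE s k)}"
proof -
  \<comment> \<open>A nonnegative rate gives at least one message, so the uniform law lives on a
    nonempty set.\<close>
  have range: "set_pmf (pmf_of_set {1..message_count n R}) = {1..message_count n R}" if "0 \<le> R" for R
    using message_count_pos[OF that, of n] by (intro set_pmf_of_set) auto
  have m: "fst m \<in> PiE_dflt (urllc_set K s) 0 (\<lambda>k. set_pmf (pmf_of_set {1..message_count n RU}))"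
    "snd m \<in> PiE_dflt (active_set K s) 0 (\<lambda>k. set_pmf (pmf_of_set {1..message_count n (RE s k)}))"
    using assms(1) by (auto simp: messages_pmf_def embb_set_def set_Pi_pmf o_def)
  show "fst m k \<in> {1..message_count n RU}" if "k \<in> urllc_set K s"
    using m(1) that unfolding PiE_dflt_def range[OF assms(2)] by auto
  show "snd m k \<in> {1..message_count n (RE s k)}" if "k \<in> active_set K s"
  proof -
    have "snd m k \<in> set_pmf (pmf_of_set {1..message_count n (RE s k)})"
      using m(2) that by (auto simp: PiE_dflt_def)
    moreover have "0 \<le> RE s k" using that assms(3) active_set_subset by blast
    ultimately show ?thesis by (simp only: range)
  qed
qed

context hex_scheme
begin

lemma scheme_power_constraint:
  assumes "(input_growth * (real Q - 1))\<^sup>2 \<le> P" "1 \<le> n"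
  shows "power_constraint K pos \<rho> \<rho>f P RU RE (Suc 0) n scheme"
proof -
  have "(1 / real n) * (\<Sum>t=1..n. (channel_input K pos (Suc 0) scheme s m k t)\<^sup>2) \<le> P" for s m k
  proof -
    have "(\<Sum>t=1..n. (channel_input K pos (Suc 0) scheme s m k t)\<^sup>2)
        \<le> (\<Sum>t=1..n. (input_growth * (real Q - 1))\<^sup>2)"
      by (intro sum_mono abs_le_square_iff[THEN iffD1] order_trans[OF abs_input_le abs_ge_self])
    also have "\<dots> \<le> real n * P"
      using assms(1) by (simp add: mult_left_mono)
    finally show ?thesis using assms(2) by (simp add: field_simps)
  qed
  then show ?thesis by (simp add: power_constraint_def)
qed

text \<open>Whatever the activity and the messages, an error forces the noise energy above four
  times its mean. The 16 combines that factor 4 with the 4 in the decoding radius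
  \<open>B / 4\<close>.\<close>

lemma scheme_error_prob:
  assumes "0 \<le> RU" "\<And>s k. k \<in> {1..K} \<Longrightarrow> 0 \<le> RE s k"
    and U: "\<And>s k. k \<in> urllc_set K s \<Longrightarrow> \<exists>f. separated_codebook Q B (U_slots k) U_count f"
    and E: "\<And>s k. k \<in> active_set K s \<Longrightarrow> \<exists>f. separated_codebook Q B (E_slots s k) (E_count s k) f"
    and B: "16 * noise_growth * real (K * n) \<le> real B"
  shows "error_prob K pos h \<rho> \<rho>f RU RE (Suc 0) ((K * K + 1) * (K + 1)) n scheme
    \<le> (sqrt 2 / exp 1) ^ (K * n)"
  unfolding error_prob_def
proof (intro expectation_le_const Bochner_Integration.integral_nonneg measure_nonneg)
  fix s m
  assume "m \<in> set_pmf (messages_pmf K n RU RE s)"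
  then have range: "k \<in> urllc_set K s \<Longrightarrow> fst m k \<in> {1..U_count}"
    "k \<in> active_set K s \<Longrightarrow> snd m k \<in> {1..E_count s k}" for k
    using messages_range assms(1,2) by blast+
  let ?N = "noise_measure K n" and ?I = "{1..K} \<times> {1..n}"
  let ?err = "{z \<in> space ?N. decoding_error K pos h (Suc 0) ((K * K + 1) * (K + 1)) n scheme s m z}"
  let ?loud = "{z \<in> space ?N. 4 * real (card ?I) < (\<Sum>i\<in>?I. (z i)\<^sup>2)}"
  have coord [measurable]: "(\<lambda>z. z i) \<in> borel_measurable ?N" if "i \<in> ?I" for i
    using measurable_component_singleton[OF that, of "\<lambda>_. density lborel std_normal_density"]
    by (simp add: noise_measure_def)
  have "?err \<subseteq> ?loud"
  proof safe
    fix z assume err: "decoding_error K pos h (Suc 0) ((K * K + 1) * (K + 1)) n scheme s m z"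
    show "4 * real (card ?I) < (\<Sum>i\<in>?I. (z i)\<^sup>2)"
    proof (rule ccontr)
      assume "\<not> ?thesis"
      then have "noise_growth * (\<Sum>i\<in>?I. (z i)\<^sup>2) \<le> noise_growth * (4 * real (card ?I))"
        by (intro mult_left_mono noise_growth_nonneg) simp
      also have "\<dots> \<le> real B / 4" using B by simp
      finally have "\<not> decoding_error K pos h (Suc 0) ((K * K + 1) * (K + 1)) n scheme s m z"
        using U E range
        by (intro not_decoding_error) (auto simp: U_book_def E_book_def intro!: separated_codebook_codebook)
      with err show False by simp
    qed
  qed
  moreover have "?loud \<in> sets ?N" by measurable
  moreover have "finite_measure ?N"
    unfolding noise_measure_def
    by (intro prob_space.finite_measure prob_space_PiM prob_space_normal_density) simp
  ultimately have "measure ?N ?err \<le> measure ?N ?loud"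
    by (intro finite_measure.finite_measure_mono)
  also have "\<dots> \<le> (sqrt 2 / exp 1) ^ card ?I"
    unfolding noise_measure_def by (rule gaussian_energy_tail) simp
  finally show "measure ?N ?err \<le> (sqrt 2 / exp 1) ^ (K * n)" by simp
qed

end

text \<open>Linearity of expectation reduces the average to the marginal law of a single
  cell.\<close>

lemma expected_activity:
  assumes "0 \<le> \<rho>" "\<rho> \<le> 1" "0 \<le> \<rho>f" "\<rho>f \<le> 1" "1 \<le> K"
  shows "measure_pmf.expectation (activity_pmf K \<rho> \<rho>f)
      (\<lambda>s. 1 / real K * (\<Sum>k\<in>embb_set K s. if k \<in> urllc_set K s then a else b))
    = \<rho> * (\<rho>f * a + (1 - \<rho>f) * b)"
proof -
  define g where "g p = (if fst p then if snd p then a else b else 0)" for p :: "bool \<times> bool"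
  have cell: "measure_pmf.expectation (cell_activity_pmf \<rho> \<rho>f) g = \<rho> * (\<rho>f * a + (1 - \<rho>f) * b)"
    unfolding cell_activity_pmf_def
    by (subst pmf_expectation_bind[of UNIV]) (use assms in \<open>auto simp: g_def UNIV_bool algebra_simps\<close>)
  have comp: "map_pmf (\<lambda>s. s k) (activity_pmf K \<rho> \<rho>f) = cell_activity_pmf \<rho> \<rho>f"
    if "k \<in> {1..K}" for k
    using that by (simp add: activity_pmf_def Pi_pmf_component)
  have total: "(\<Sum>k\<in>embb_set K s. if k \<in> urllc_set K s then a else b) = (\<Sum>k\<in>{1..K}. g (s k))" for s
    by (rule sum.mono_neutral_cong_left) (auto simp: embb_set_def active_set_def urllc_set_def g_def)
  have "measure_pmf.expectation (activity_pmf K \<rho> \<rho>f)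
      (\<lambda>s. 1 / real K * (\<Sum>k\<in>embb_set K s. if k \<in> urllc_set K s then a else b))
    = 1 / real K * (\<Sum>k\<in>{1..K}. measure_pmf.expectation (activity_pmf K \<rho> \<rho>f) (\<lambda>s. g (s k)))"
  proof -
    have "integrable (measure_pmf (activity_pmf K \<rho> \<rho>f)) (\<lambda>s. g (s k))" for k
      by (rule measure_pmf.integrable_const_bound[of _ "\<bar>a\<bar> + \<bar>b\<bar>"]) (auto simp: g_def)
    then show ?thesis by (simp add: total)
  qed
  also have "(\<Sum>k\<in>{1..K}. measure_pmf.expectation (activity_pmf K \<rho> \<rho>f) (\<lambda>s. g (s k)))
      = (\<Sum>k\<in>{1..K}. measure_pmf.expectation (cell_activity_pmf \<rho> \<rho>f) g)"
    by (intro sum.cong refl) (subst comp[symmetric], auto)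
  finally show ?thesis using assms(5) by (simp add: cell)
qed

text \<open>
  Compared with all grid points, greedy codebooks lose only a constant factor per symbol, and a
  small power of P absorbs it.
\<close>

lemma codebook_rate:
  fixes W \<epsilon> \<beta> :: real
  assumes "1 \<le> W" "0 < \<epsilon>" "\<epsilon> < 1" "0 \<le> \<beta>"
  shows "\<forall>\<^sub>F P in at_top. \<forall>\<^sub>F n in sequentially. \<forall>T :: nat set.
    finite T \<longrightarrow> card T \<le> n \<longrightarrow> \<beta> * real n - 1 \<le> real (card T) \<longrightarrow>
    (\<exists>f. separated_codebook (nat \<lfloor>sqrt P / W\<rfloor> + 1) (D * n) T
           (message_count n ((1 - \<epsilon>) * \<beta> * (1 / 2 * log 2 P))) f)"
proof (cases "\<beta> = 0")
  \<comment> \<open>At rate zero there is a single codeword, with nothing to separate.\<close>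
  case True
  then show ?thesis
    by (auto intro!: always_eventually separated_codebook_exists simp: message_count_zero)
next
  case False
  then have \<beta>: "0 < \<beta>" using assms(4) by simp
  \<comment> \<open>The growth per symbol of the ball bound at squared radius
    \<open>D * n\<close>.\<close>
  define C :: real where "C = 2 ^ D * 4"
  have C: "1 \<le> C" unfolding C_def using one_le_power[of "2 :: real" D] by linarith
  define P0 where "P0 = max 1 ((C * W) powr (4 / (\<epsilon> * \<beta>)))"
  show ?thesis
  proof (rule eventually_at_top_linorderI[of P0])
    fix P assume "P0 \<le> P"
    then have P: "1 \<le> P" "(C * W) powr (4 / (\<epsilon> * \<beta>)) \<le> P" by (simp_all add: P0_def)
    let ?Q = "nat \<lfloor>sqrt P / W\<rfloor> + 1" and ?R = "(1 - \<epsilon>) * \<beta> * (1 / 2 * log 2 P)"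
    have "((C * W) powr (4 / (\<epsilon> * \<beta>))) powr (\<epsilon> * \<beta> / 4) \<le> P powr (\<epsilon> * \<beta> / 4)"
      using P(2) assms(2) \<beta> by (intro powr_mono2) auto
    then have CW: "C * W \<le> P powr (\<epsilon> * \<beta> / 4)"
      using C assms(1,2) \<beta> by (simp add: powr_powr)
    show "\<forall>\<^sub>F n in sequentially. \<forall>T :: nat set. finite T \<longrightarrow> card T \<le> n \<longrightarrow>
      \<beta> * real n - 1 \<le> real (card T) \<longrightarrow> (\<exists>f. separated_codebook ?Q (D * n) T (message_count n ?R) f)"
    proof (rule eventually_sequentiallyI[of "nat \<lceil>2 / (\<epsilon> * \<beta>)\<rceil>"], intro allI impI)
      fix n and T :: "nat set"
      assume "nat \<lceil>2 / (\<epsilon> * \<beta>)\<rceil> \<le> n" and T: "finite T" "card T \<le> n" "\<beta> * real n - 1 \<le> real (card T)"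
      then have "2 / (\<epsilon> * \<beta>) \<le> real n" by linarith
      then have n: "2 \<le> \<epsilon> * \<beta> * real n" using assms(2) \<beta> by (simp add: field_simps)
      let ?M = "message_count n ?R"
      have M1: "0 < ?M" using P(1) assms \<beta> by (intro message_count_pos) simp
      have "real ?M \<le> 2 powr (real n * ?R)"
        by (simp add: message_count_def)
      also have "\<dots> = (2 powr log 2 P) powr ((1 - \<epsilon>) * \<beta> * real n / 2)"
        by (simp add: powr_powr mult_ac)
      also have "\<dots> = P powr ((1 - \<epsilon>) * \<beta> * real n / 2)"
        using P(1) by simp
      finally have M: "real ?M \<le> P powr ((1 - \<epsilon>) * \<beta> * real n / 2)" .
      have "(2::real) ^ (D * n) * 4 ^ card T \<le> 2 ^ (D * n) * 4 ^ n"
        using T(2) by (intro mult_left_mono power_increasing) auto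
      also have "\<dots> = C ^ n" by (simp add: C_def power_mult power_mult_distrib)
      finally have V: "(2::real) ^ (D * n) * 4 ^ card T \<le> C ^ n" .
      have "real (?M - 1) * (2 ^ (D * n) * 4 ^ card T) * W ^ card T
          < real ?M * C ^ n * W ^ n"
      proof -
        have "real (?M - 1) * (2 ^ (D * n) * 4 ^ card T) * W ^ card T \<le> real (?M - 1) * C ^ n * W ^ n"
          using V T(2) assms(1) C by (intro mult_mono power_increasing) auto
        also have "\<dots> < real ?M * C ^ n * W ^ n"
          using M1 C assms(1) by (intro mult_strict_right_mono) auto
        finally show ?thesis .
      qed
      also have "\<dots> = real ?M * (C * W) ^ n" by (simp add: power_mult_distrib)
      also have "\<dots> \<le> P powr ((1 - \<epsilon>) * \<beta> * real n / 2) * (P powr (\<epsilon> * \<beta> / 4)) ^ n"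
        using M CW C assms(1) by (intro mult_mono power_mono) auto
      also have "\<dots> = P powr ((1 - \<epsilon>) * \<beta> * real n / 2 + \<epsilon> * \<beta> / 4 * real n)"
        using P(1) by (simp add: powr_add powr_powr flip: powr_realpow)
      also have "\<dots> \<le> P powr (1 / 2 * real (card T))"
        using n T(3) P(1) by (intro powr_mono) (simp_all add: field_simps)
      also have "\<dots> = sqrt P ^ card T"
        using P(1) by (simp add: powr_half_sqrt[symmetric] powr_powr flip: powr_realpow)
      finally have "real (?M - 1) * (2 ^ (D * n) * 4 ^ card T) < (sqrt P / W) ^ card T"
        using assms(1) by (simp add: power_divide field_simps)
      also have "\<dots> \<le> real ?Q ^ card T"
        using P(1) assms(1) by (intro power_mono) (linarith, simp)
      finally show "\<exists>f. separated_codebook ?Q (D * n) T ?M f"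
        using T(1) by (intro separated_codebook_exists) auto
    qed
  qed
qed

context hex_network
begin

lemma achievable_rates_of_codebooks:
  fixes \<alpha> \<epsilon> L P :: real
  assumes "0 \<le> \<alpha>" "\<alpha> \<le> 1 / 3" "0 < \<epsilon>" "\<epsilon> < 1" "0 \<le> L" "0 < P" "1 \<le> K"
    and \<rho>: "0 \<le> \<rho>" "\<rho> \<le> 1" "0 \<le> \<rho>f" "\<rho>f \<le> 1"
    and D: "16 * noise_growth * real K \<le> real D"
    and books: "\<forall>\<^sub>F n in sequentially. \<forall>\<beta>\<in>{\<alpha>, 1 - \<alpha>, 1}. \<forall>T :: nat set.
      finite T \<longrightarrow> card T \<le> n \<longrightarrow> \<beta> * real n - 1 \<le> real (card T) \<longrightarrow>
      (\<exists>f. separated_codebook (nat \<lfloor>sqrt P / input_growth\<rfloor> + 1) (D * n) T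
             (message_count n ((1 - \<epsilon>) * \<beta> * L)) f)"
    and S: "0 \<le> S" "S \<le> \<rho> - \<rho> * \<rho>f * \<alpha>"
  shows "achievable_rates K pos h \<rho> \<rho>f P ((1 - \<epsilon>) * \<alpha> * L) ((1 - \<epsilon>) * S * L)"
proof -
  define \<beta> where "\<beta> s k = (if k \<in> urllc_set K s then 1 - \<alpha> else 1)" for s k
  define RE where "RE s k = (1 - \<epsilon>) * \<beta> s k * L" for s k
  define Q where "Q = nat \<lfloor>sqrt P / input_growth\<rfloor> + 1"
  let ?RU = "(1 - \<epsilon>) * \<alpha> * L"
  let ?DR = "(K * K + 1) * (K + 1)"
  let ?c = "\<lambda>n. hex_scheme.scheme K pos h \<alpha> ?RU RE n Q (D * n)"
  have scheme: "hex_scheme K pos h \<alpha> Q"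
    using assms(1,2) by unfold_locales (simp_all add: Q_def)
  have RU0: "0 \<le> ?RU" and RE0: "0 \<le> RE s k" for s k
    using assms by (auto simp: RE_def \<beta>_def)
  have power: "(input_growth * (real Q - 1))\<^sup>2 \<le> P"
  proof -
    have "real Q - 1 \<le> sqrt P / input_growth"
      using input_growth_ge_1 \<open>0 < P\<close> by (simp add: Q_def)
    then have "input_growth * (real Q - 1) \<le> sqrt P" "0 \<le> input_growth * (real Q - 1)"
      using input_growth_ge_1 by (simp_all add: Q_def field_simps)
    then have "(input_growth * (real Q - 1))\<^sup>2 \<le> (sqrt P)\<^sup>2" by (intro power_mono)
    then show ?thesis using \<open>0 < P\<close> by simp
  qed
  have bound: "\<forall>\<^sub>F n in sequentially.
    error_prob K pos h \<rho> \<rho>f ?RU RE (Suc 0) ?DR n (?c n) \<le> (sqrt 2 / exp 1) ^ n"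
    using books
  proof eventually_elim
    case (elim n)
    interpret hex_scheme K pos h \<alpha> ?RU RE n Q "D * n" by (rule scheme)
    have floor: "\<alpha> * real n - 1 \<le> real (nat \<lfloor>\<alpha> * real n\<rfloor>)" "real (nat \<lfloor>\<alpha> * real n\<rfloor>) \<le> \<alpha> * real n"
      using assms(1) by linarith (simp add: assms(1))
    have "\<alpha> * real n \<le> real n" using mult_right_mono[of \<alpha> 1 "real n"] assms(2) by simp
    then have floor': "real (n - nat \<lfloor>\<alpha> * real n\<rfloor>) = real n - real (nat \<lfloor>\<alpha> * real n\<rfloor>)"
      using floor(2) by (subst of_nat_diff) linarith+
    have "error_prob K pos h \<rho> \<rho>f ?RU RE (Suc 0) ?DR n scheme \<le> (sqrt 2 / exp 1) ^ (K * n)"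
    proof (rule scheme_error_prob)
      show "\<exists>f. separated_codebook Q (D * n) (U_slots k) U_count f" for k
        using elim card_mono[OF _ U_slots_subset[of k]] floor(1) unfolding Q_def
        by (intro elim[rule_format]) (simp_all add: card_U_slots)
      show "\<exists>f. separated_codebook Q (D * n) (E_slots s k) (E_count s k) f" for s k
        unfolding RE_def Q_def using floor floor'
        by (intro elim[rule_format]) (auto simp: card_E_slots \<beta>_def algebra_simps)
      show "16 * noise_growth * real (K * n) \<le> real (D * n)"
        using mult_right_mono[OF D, of "real n"] by (simp add: mult_ac)
    qed (use RU0 RE0 in auto)
    also have "\<dots> \<le> (sqrt 2 / exp 1) ^ n"
    proof (rule power_decreasing)
      have "sqrt 2 \<le> exp (1 :: real)"
        using exp_ge_add_one_self[of 1] real_sqrt_le_mono[of 2 4] by simp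
      then show "sqrt 2 / exp 1 \<le> (1 :: real)" by simp
    qed (use \<open>1 \<le> K\<close> in auto)
    finally show ?case .
  qed
  have "(\<lambda>n. error_prob K pos h \<rho> \<rho>f ?RU RE (Suc 0) ?DR n (?c n)) \<longlonglongrightarrow> 0"
  proof (rule tendsto_sandwich[OF _ bound tendsto_const])
    show "\<forall>\<^sub>F n in sequentially. 0 \<le> error_prob K pos h \<rho> \<rho>f ?RU RE (Suc 0) ?DR n (?c n)"
      unfolding error_prob_def by (auto intro!: always_eventually Bochner_Integration.integral_nonneg)
    have "sqrt 2 < exp (1 :: real)"
      using exp_ge_add_one_self[of 1] real_sqrt_less_mono[of 2 4] by simp
    then show "(\<lambda>n. (sqrt 2 / exp 1 :: real) ^ n) \<longlonglongrightarrow> 0"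
      by (intro LIMSEQ_power_zero) simp
  qed
  moreover have "measurable_code (?c n)" for n
    using hex_scheme.measurable_scheme[OF scheme] .
  moreover have "power_constraint K pos \<rho> \<rho>f P ?RU RE (Suc 0) n (?c n)" if "1 \<le> n" for n
    using hex_scheme.scheme_power_constraint[OF scheme power that] .
  moreover have "(1 - \<epsilon>) * S * L \<le> measure_pmf.expectation (activity_pmf K \<rho> \<rho>f)
      (\<lambda>s. 1 / real K * (\<Sum>k\<in>embb_set K s. RE s k))"
  proof -
    have "(1 - \<epsilon>) * L * S \<le> (1 - \<epsilon>) * L * (\<rho> - \<rho> * \<rho>f * \<alpha>)"
      using S(2) assms by (intro mult_left_mono) auto
    also have "\<dots> = \<rho> * (\<rho>f * ((1 - \<epsilon>) * (1 - \<alpha>) * L) + (1 - \<rho>f) * ((1 - \<epsilon>) * 1 * L))"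
      by (simp add: algebra_simps)
    also have "\<dots> = measure_pmf.expectation (activity_pmf K \<rho> \<rho>f) (\<lambda>s. 1 / real K *
        (\<Sum>k\<in>embb_set K s. if k \<in> urllc_set K s then (1 - \<epsilon>) * (1 - \<alpha>) * L else (1 - \<epsilon>) * 1 * L))"
      by (rule expected_activity[symmetric]) (use \<rho> \<open>1 \<le> K\<close> in auto)
    also have "\<dots> = measure_pmf.expectation (activity_pmf K \<rho> \<rho>f)
        (\<lambda>s. 1 / real K * (\<Sum>k\<in>embb_set K s. RE s k))"
      by (intro arg_cong[of _ _ "measure_pmf.expectation (activity_pmf K \<rho> \<rho>f)"] ext)
        (auto simp: RE_def \<beta>_def intro!: sum.cong)
    finally show ?thesis by (simp add: mult_ac)
  qed
  ultimately show ?thesis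
    unfolding achievable_rates_def
    using RU0 RE0 assms(4,5) S(1)
    by (intro conjI, simp, simp, intro exI[of _ RE] conjI, simp, simp)
      (rule exI[of _ "Suc 0"], rule exI[of _ ?DR], rule exI[of _ ?c], simp)
qed

lemma achievable_multiplexing_gains:
  assumes "0 \<le> \<alpha>" "\<alpha> \<le> 1 / 3" "0 < \<epsilon>" "\<epsilon> < 1" "1 \<le> K"
    and "0 \<le> \<rho>" "\<rho> \<le> 1" "0 \<le> \<rho>f" "\<rho>f \<le> 1"
    and "0 \<le> S" "S \<le> \<rho> - \<rho> * \<rho>f * \<alpha>"
  shows "\<exists>P0. \<forall>P>0. achievable_rates K pos h \<rho> \<rho>f P
    ((1 - \<epsilon>) * \<alpha> * (if P0 \<le> P then 1 / 2 * log 2 P else 0))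
    ((1 - \<epsilon>) * S * (if P0 \<le> P then 1 / 2 * log 2 P else 0))"
proof -
  define D where "D = nat \<lceil>16 * noise_growth * real K\<rceil>"
  have D: "16 * noise_growth * real K \<le> real D"
    unfolding D_def by linarith
  have "\<forall>\<^sub>F P in at_top. \<forall>\<beta>\<in>{\<alpha>, 1 - \<alpha>, 1}. \<forall>\<^sub>F n in sequentially. \<forall>T :: nat set.
      finite T \<longrightarrow> card T \<le> n \<longrightarrow> \<beta> * real n - 1 \<le> real (card T) \<longrightarrow>
      (\<exists>f. separated_codebook (nat \<lfloor>sqrt P / input_growth\<rfloor> + 1) (D * n) T
             (message_count n ((1 - \<epsilon>) * \<beta> * (1 / 2 * log 2 P))) f)"
    using assms by (intro eventually_ball_finite ballI codebook_rate input_growth_ge_1) auto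
  then obtain P0 where P0: "\<forall>\<beta>\<in>{\<alpha>, 1 - \<alpha>, 1}. \<forall>\<^sub>F n in sequentially. \<forall>T :: nat set.
      finite T \<longrightarrow> card T \<le> n \<longrightarrow> \<beta> * real n - 1 \<le> real (card T) \<longrightarrow>
      (\<exists>f. separated_codebook (nat \<lfloor>sqrt P / input_growth\<rfloor> + 1) (D * n) T
             (message_count n ((1 - \<epsilon>) * \<beta> * (1 / 2 * log 2 P))) f)" if "P0 \<le> P" for P
    unfolding eventually_at_top_linorder by blast
  have "achievable_rates K pos h \<rho> \<rho>f P
    ((1 - \<epsilon>) * \<alpha> * (if max 1 P0 \<le> P then 1 / 2 * log 2 P else 0))
    ((1 - \<epsilon>) * S * (if max 1 P0 \<le> P then 1 / 2 * log 2 P else 0))" if "0 < P" for P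
  proof (rule achievable_rates_of_codebooks)
    show "\<forall>\<^sub>F n in sequentially. \<forall>\<beta>\<in>{\<alpha>, 1 - \<alpha>, 1}. \<forall>T :: nat set.
      finite T \<longrightarrow> card T \<le> n \<longrightarrow> \<beta> * real n - 1 \<le> real (card T) \<longrightarrow>
      (\<exists>f. separated_codebook (nat \<lfloor>sqrt P / input_growth\<rfloor> + 1) (D * n) T
             (message_count n ((1 - \<epsilon>) * \<beta> * (if max 1 P0 \<le> P then 1 / 2 * log 2 P else 0))) f)"
    proof (cases "max 1 P0 \<le> P")
      case True
      then show ?thesis using P0[of P] by (intro eventually_ball_finite) auto
    next
      case False
      then show ?thesis
        by (auto intro!: always_eventually separated_codebook_exists simp: message_count_zero)
    qed
  qed (use assms that D in auto)
  then show ?thesis by blast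
qed

end

lemma mg_eq:
  assumes "\<And>K. 1 \<le> K \<Longrightarrow> \<exists>P0. \<forall>P\<ge>P0. R K P = a * (1 / 2 * log 2 P)"
  shows "mg R = ereal a"
proof -
  have inner: "Limsup at_top (\<lambda>P. ereal (R K P / (1 / 2 * log 2 P))) = ereal a" if K: "1 \<le> K" for K
  proof -
    obtain P0 where P0: "\<And>P. P0 \<le> P \<Longrightarrow> R K P = a * (1 / 2 * log 2 P)"
      using assms[OF K] by blast
    have "\<forall>\<^sub>F P in at_top. ereal (R K P / (1 / 2 * log 2 P)) = ereal a"
    proof (rule eventually_at_top_linorderI[of "max 2 P0"])
      fix P assume "max 2 P0 \<le> P"
      then have "0 < log 2 P" "R K P = a * (1 / 2 * log 2 P)" by (auto simp: P0)
      then show "ereal (R K P / (1 / 2 * log 2 P)) = ereal a" by simp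
    qed
    then have "Limsup at_top (\<lambda>P. ereal (R K P / (1 / 2 * log 2 P))) = Limsup at_top (\<lambda>P :: real. ereal a)"
      by (rule Limsup_eq)
    then show ?thesis by (simp add: Limsup_const)
  qed
  have "mg R = limsup (\<lambda>K :: nat. ereal a)"
    unfolding mg_def by (rule Limsup_eq) (use inner in \<open>auto intro!: eventually_sequentiallyI[of 1]\<close>)
  then show ?thesis by (simp add: Limsup_const)
qed

theorem proposition5:
  fixes pos :: "nat \<Rightarrow> nat \<Rightarrow> int \<times> int"
    and h :: "nat \<Rightarrow> nat \<Rightarrow> nat \<Rightarrow> real"
    and \<rho> \<rho>f :: real
  assumes "\<And>K. inj_on (pos K) {1..K}"
    and "\<And>K j k. 0 \<le> h K j k"
    and "\<And>K. generic_gains K (pos K) (h K)"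
    and "0 < \<rho>" "\<rho> \<le> 1"
    and "0 \<le> \<rho>f" "\<rho>f \<le> 1"
  shows "{(SU, SE). 0 \<le> SU \<and> 0 \<le> SE \<and> SU \<le> \<rho> * \<rho>f / 3 \<and> SE + SU \<le> \<rho>} \<subseteq> mg_region pos h \<rho> \<rho>f"
proof safe
  fix SU SE :: real
  assume S: "0 \<le> SU" "0 \<le> SE" "SU \<le> \<rho> * \<rho>f / 3" "SE + SU \<le> \<rho>"
  define \<alpha> where "\<alpha> = SU / (\<rho> * \<rho>f)"
  have SU: "\<rho> * \<rho>f * \<alpha> = SU"
    using S(1,3) assms(4) by (cases "\<rho>f = 0") (auto simp: \<alpha>_def)
  have \<alpha>: "0 \<le> \<alpha>" "\<alpha> \<le> 1 / 3"
    using S(1,3) assms(4,6) by (auto simp: \<alpha>_def divide_le_eq zero_le_mult_iff less_eq_real_def)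
  have "achievable_mg_pair pos h \<rho> \<rho>f ((1 - \<epsilon>) * SU, (1 - \<epsilon>) * SE)" if \<epsilon>: "0 < \<epsilon>" "\<epsilon> < 1" for \<epsilon>
  proof -
    have "\<exists>P0. \<forall>P>0. achievable_rates K (pos K) (h K) \<rho> \<rho>f P
        ((1 - \<epsilon>) * \<alpha> * (if P0 \<le> P then 1 / 2 * log 2 P else 0))
        ((1 - \<epsilon>) * SE * (if P0 \<le> P then 1 / 2 * log 2 P else 0))" if "1 \<le> K" for K
    proof -
      interpret hex_network K "pos K" "h K" by unfold_locales (rule assms(3))
      show ?thesis
        using \<alpha> \<epsilon> that assms(4-7) S SU by (intro achievable_multiplexing_gains) auto
    qed
    then obtain P0 where P0: "\<And>K P. 1 \<le> K \<Longrightarrow> 0 < P \<Longrightarrow> achievable_rates K (pos K) (h K) \<rho> \<rho>f P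
        ((1 - \<epsilon>) * \<alpha> * (if P0 K \<le> P then 1 / 2 * log 2 P else 0))
        ((1 - \<epsilon>) * SE * (if P0 K \<le> P then 1 / 2 * log 2 P else 0))"
      by metis
    define R where "R a K P = (1 - \<epsilon>) * a * (if P0 K \<le> P then 1 / 2 * log 2 P else 0)" for a K P
    have "mg (R a) = ereal ((1 - \<epsilon>) * a)" for a
      by (intro mg_eq) (auto simp: R_def intro!: exI[of _ "P0 _"])
    moreover have "\<rho> * \<rho>f * ((1 - \<epsilon>) * \<alpha>) = (1 - \<epsilon>) * SU"
      by (simp add: SU[symmetric])
    ultimately show ?thesis
      unfolding achievable_mg_pair_def using P0
      by - (rule exI[of _ "R \<alpha>"], rule exI[of _ "R SE"], auto simp: R_def)
  qed
  note approximant = this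
  have "(\<lambda>i. ((1 - 1 / (real i + 2)) * SU, (1 - 1 / (real i + 2)) * SE)) \<longlonglongrightarrow> ((1 - 0) * SU, (1 - 0) * SE)"
    by (intro tendsto_intros tendsto_Pair) real_asymp+
  then show "(SU, SE) \<in> mg_region pos h \<rho> \<rho>f"
    unfolding mg_region_def closure_sequential using approximant
    by (intro exI[of _ "\<lambda>i. ((1 - 1 / (real i + 2)) * SU, (1 - 1 / (real i + 2)) * SE)"]) auto
qed

end
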